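(* Let $\Pi=(\Sigma,\mathcal{V},\mathcal{E})$ be an LCL on $\Delta$-regular trees that is solvable in $\mathsf{LOCAL}(n^{o(1)})$ rounds. Then there exists an $\ell$-full set $\mathcal{V}'\subseteq\mathcal{V}$ for some $\ell\ge 2$.
   Context: $\Delta>2$. A finite $\Delta$-regular tree is a finite tree of maximum degree $\le\Delta$ in which each vertex of degree $d$ additionally has $\Delta-d$ virtual half-edges (belonging to no edge); real half-edges are pairs $(v,e)$. An LCL $\Pi=(\Sigma,\mathcal{V},\mathcal{E})$: $\Sigma$ finite, $\mathcal{V}$ a set of size-$\Delta$ multisets over $\Sigma$, $\mathcal{E}$ a set of size-2 multisets; a $\Pi$-coloring labels all half-edges so that the multiset at every vertex is in $\mathcal{V}$ and on every edge in $\mathcal{E}$. Solvable in $\mathsf{LOCAL}(n^{o(1)})$: there is a deterministic local algorithm of complexity $t(n)=n^{o(1)}$, i.e. a function of $n$ and the radius-$t(n)$ neighborhood of a vertex (with identifiers) outputting its half-edge labels, which on every $n$-vertex $\Delta$-regular tree with distinct identifiers from $\{1,\dots,n^C\}$ yields a $\Pi$-coloring. $\mathcal{V}'\subseteq\mathcal{V}$ is $\ell$-full if for every path with at least $\ell$ vertices (completed to $\Delta$ half-edges per vertex) and all $c_1,c_2\in\mathcal{V}'$, any labeling of the endpoints' half-edges by $c_1$ and $c_2$ extends to the remaining vertices using configurations from $\mathcal{V}'$ so that all edges of the path have configurations in $\mathcal{E}$. *)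

theory Defs
  imports "HOL-Library.Multiset" "HOL-Library.Landau_Symbols"
begin

section \<open>Finite regular trees with half-edges\<close>

text \<open>
  A graph is a vertex set together with a set of edges, each edge being a two-element vertex set.
\<close>

record 'v graph =
  verts :: "'v set"
  edges :: "'v set set"

definition simple_graph :: "'v graph \<Rightarrow> bool" where
  "simple_graph G \<longleftrightarrow> finite (verts G) \<and> (\<forall>e\<in>edges G. e \<subseteq> verts G \<and> card e = 2)"

definition walk :: "'v graph \<Rightarrow> 'v list \<Rightarrow> bool" where
  "walk G xs \<longleftrightarrow> xs \<noteq> [] \<and> set xs \<subseteq> verts G \<and> successively (\<lambda>u v. {u, v} \<in> edges G) xs"

definition walk_betw :: "'v graph \<Rightarrow> 'v \<Rightarrow> 'v list \<Rightarrow> 'v \<Rightarrow> bool" where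
  "walk_betw G u xs v \<longleftrightarrow> walk G xs \<and> hd xs = u \<and> last xs = v"

definition connected_graph :: "'v graph \<Rightarrow> bool" where
  "connected_graph G \<longleftrightarrow> (\<forall>u\<in>verts G. \<forall>v\<in>verts G. \<exists>xs. walk_betw G u xs v)"

definition cycle :: "'v graph \<Rightarrow> 'v list \<Rightarrow> bool" where
  "cycle G xs \<longleftrightarrow> walk G xs \<and> distinct xs \<and> 3 \<le> length xs \<and> {last xs, hd xs} \<in> edges G"

definition tree :: "'v graph \<Rightarrow> bool" where
  "tree G \<longleftrightarrow> simple_graph G \<and> verts G \<noteq> {} \<and> connected_graph G \<and> \<not> (\<exists>xs. cycle G xs)"

definition incident :: "'v graph \<Rightarrow> 'v \<Rightarrow> 'v set set" where
  "incident G v = {e \<in> edges G. v \<in> e}"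

definition degree :: "'v graph \<Rightarrow> 'v \<Rightarrow> nat" where
  "degree G v = card (incident G v)"

text \<open>
  The virtual half-edges of a tree of maximum degree at most \<open>\<Delta>\<close> are determined by the tree,
  see \<open>half_edges_at\<close> below.
\<close>

definition regular_tree :: "nat \<Rightarrow> 'v graph \<Rightarrow> bool" where
  "regular_tree \<Delta> G \<longleftrightarrow> tree G \<and> (\<forall>v\<in>verts G. degree G v \<le> \<Delta>)"

text \<open>
  \<open>Real v e\<close> is the pair of a vertex and an incident edge; \<open>Virtual v i\<close> is the \<open>i\<close>-th virtual
  half-edge at \<open>v\<close>, where \<open>i < \<Delta> - degree G v\<close>.
\<close>

datatype 'v half_edge = Real 'v "'v set" | Virtual 'v nat

definition half_edges_at :: "nat \<Rightarrow> 'v graph \<Rightarrow> 'v \<Rightarrow> 'v half_edge set" where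
  "half_edges_at \<Delta> G v = Real v ` incident G v \<union> Virtual v ` {..<\<Delta> - degree G v}"


section \<open>LCL problems\<close>

record 'a lcl =
  labels :: "'a set"
  vertex_configs :: "'a multiset set"
  edge_configs :: "'a multiset set"

definition lcl_on_regular_trees :: "nat \<Rightarrow> 'a lcl \<Rightarrow> bool" where
  "lcl_on_regular_trees \<Delta> \<Pi> \<longleftrightarrow> finite (labels \<Pi>)
     \<and> (\<forall>c\<in>vertex_configs \<Pi>. size c = \<Delta> \<and> set_mset c \<subseteq> labels \<Pi>)
     \<and> (\<forall>c\<in>edge_configs \<Pi>. size c = 2 \<and> set_mset c \<subseteq> labels \<Pi>)"

definition coloring :: "nat \<Rightarrow> 'a lcl \<Rightarrow> 'v graph \<Rightarrow> ('v half_edge \<Rightarrow> 'a) \<Rightarrow> bool" where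
  "coloring \<Delta> \<Pi> G h \<longleftrightarrow>
     (\<forall>v\<in>verts G. h ` half_edges_at \<Delta> G v \<subseteq> labels \<Pi>
        \<and> image_mset h (mset_set (half_edges_at \<Delta> G v)) \<in> vertex_configs \<Pi>)
     \<and> (\<forall>u v. {u, v} \<in> edges G \<longrightarrow> {#h (Real u {u, v}), h (Real v {u, v})#} \<in> edge_configs \<Pi>)"


section \<open>Local algorithms\<close>

definition ball_verts :: "'v graph \<Rightarrow> 'v \<Rightarrow> nat \<Rightarrow> 'v set" where
  "ball_verts G v r = {u \<in> verts G. \<exists>xs. walk_betw G v xs u \<and> length xs \<le> r + 1}"

text \<open>
  What a vertex sees within radius \<open>r\<close>: the subgraph induced by the ball, every vertex being
  given by its identifier.  The half-edges at the vertices of the ball are part of the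
  neighbourhood, so the degree of each vertex of the ball is visible, including those on
  the boundary.  As identifiers are distinct, two such views are equal iff the neighbourhoods are
  isomorphic as rooted graphs with identifiers.
\<close>

record view =
  view_center :: nat
  view_graph :: "nat graph"
  view_degrees :: "(nat \<times> nat) set"

definition neighbourhood :: "'v graph \<Rightarrow> ('v \<Rightarrow> nat) \<Rightarrow> 'v \<Rightarrow> nat \<Rightarrow> view" where
  "neighbourhood G ident v r =
     \<lparr>view_center = ident v,
      view_graph = \<lparr>verts = ident ` ball_verts G v r,
                    edges = (`) ident ` {e \<in> edges G. e \<subseteq> ball_verts G v r}\<rparr>,
      view_degrees = (\<lambda>u. (ident u, degree G u)) ` ball_verts G v r\<rparr>"

text \<open>
  Given the number \<open>n\<close> of vertices and the view of a vertex, an algorithm labels the half-edges of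
  that vertex.  These are named through identifiers, since an algorithm has no other access
  to the vertices of the graph.
\<close>

type_synonym 'a local_algorithm = "nat \<Rightarrow> view \<Rightarrow> nat half_edge \<Rightarrow> 'a"

fun run :: "'a local_algorithm \<Rightarrow> (nat \<Rightarrow> nat) \<Rightarrow> 'v graph \<Rightarrow> ('v \<Rightarrow> nat) \<Rightarrow> 'v half_edge \<Rightarrow> 'a"
  where
    "run A t G ident (Real v e) =
       A (card (verts G)) (neighbourhood G ident v (t (card (verts G)))) (Real (ident v) (ident ` e))"
  | "run A t G ident (Virtual v i) =
       A (card (verts G)) (neighbourhood G ident v (t (card (verts G)))) (Virtual (ident v) i)"

definition valid_identifiers :: "nat \<Rightarrow> 'v graph \<Rightarrow> ('v \<Rightarrow> nat) \<Rightarrow> bool" where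
  "valid_identifiers C G ident \<longleftrightarrow>
     inj_on ident (verts G) \<and> ident ` verts G \<subseteq> {1..card (verts G) ^ C}"

text \<open>
  Every finite graph is isomorphic to one with vertices in \<^typ>\<open>nat\<close>.
\<close>

definition solves :: "nat \<Rightarrow> nat \<Rightarrow> 'a lcl \<Rightarrow> 'a local_algorithm \<Rightarrow> (nat \<Rightarrow> nat) \<Rightarrow> bool" where
  "solves C \<Delta> \<Pi> A t \<longleftrightarrow>
     (\<forall>(G :: nat graph) ident. regular_tree \<Delta> G \<and> valid_identifiers C G ident
        \<longrightarrow> coloring \<Delta> \<Pi> G (run A t G ident))"

text \<open>\<open>t(n) = n\<^bsup>o(1)\<^esup>\<close>, as an upper bound on \<open>t\<close>.\<close>

definition subpolynomial :: "(nat \<Rightarrow> nat) \<Rightarrow> bool" where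
  "subpolynomial t \<longleftrightarrow>
     (\<exists>f :: nat \<Rightarrow> real. f \<in> o(\<lambda>_. 1) \<and> (\<forall>\<^sub>F n in sequentially. real (t n) \<le> real n powr f n))"

definition solvable_in_LOCAL_subpolynomial :: "nat \<Rightarrow> nat \<Rightarrow> 'a lcl \<Rightarrow> bool" where
  "solvable_in_LOCAL_subpolynomial C \<Delta> \<Pi> \<longleftrightarrow> (\<exists>A t. subpolynomial t \<and> solves C \<Delta> \<Pi> A t)"


section \<open>Full sets of vertex configurations\<close>

definition config :: "nat \<Rightarrow> (nat \<Rightarrow> 'a) \<Rightarrow> 'a multiset" where
  "config \<Delta> p = image_mset p (mset_set {..<\<Delta>})"

text \<open>
  The path has vertices \<open>0, \<dots>, m - 1\<close>, each with half-edges \<open>0, \<dots>, \<Delta> - 1\<close>, and \<open>lab i j\<close> is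
  the label of half-edge \<open>j\<close> at vertex \<open>i\<close>.  The path edge between \<open>i\<close> and \<open>i + 1\<close> consists of
  half-edge 1 at \<open>i\<close> and half-edge 0 at \<open>i + 1\<close>; all other half-edges belong to no path edge.
  The notion is meant for \<open>\<Delta> \<ge> 2\<close> and \<open>l \<ge> 2\<close>.
\<close>

definition full :: "nat \<Rightarrow> 'a lcl \<Rightarrow> nat \<Rightarrow> 'a multiset set \<Rightarrow> bool" where
  "full \<Delta> \<Pi> l V' \<longleftrightarrow>
     (\<forall>m\<ge>l. \<forall>c1\<in>V'. \<forall>c2\<in>V'. \<forall>p q. config \<Delta> p = c1 \<and> config \<Delta> q = c2 \<longrightarrow>
        (\<exists>lab :: nat \<Rightarrow> nat \<Rightarrow> 'a.
            (\<forall>j<\<Delta>. lab 0 j = p j) \<and> (\<forall>j<\<Delta>. lab (m - 1) j = q j)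
          \<and> (\<forall>i. 0 < i \<and> i < m - 1 \<longrightarrow> config \<Delta> (lab i) \<in> V')
          \<and> (\<forall>i. i + 1 < m \<longrightarrow> {#lab i 1, lab (i + 1) 0#} \<in> edge_configs \<Pi>)))"

end

theory Submission
  imports Defs
begin

text \<open>
  Fix \<open>n\<close> much larger than a polynomial in \<open>s = t(n) + 1\<close> and let \<open>V\<^sub>i(S)\<close> be the set of configurations
  that the algorithm outputs at roots of trees with identifiers in \<open>S\<close>, all of whose branches have
  rank \<open>i\<close>: a branch of rank \<open>i + 1\<close> starts with a path of \<open>s\<close> vertices off which branches of rank \<open>i\<close>
  hang.  These trees have size polynomial in \<open>s\<close>; they are padded to \<open>n\<close> vertices out of sight of the
  vertices of interest.

  Suppose \<open>S\<^sub>1, S\<^sub>2, S\<^sub>3 \<subseteq> S\<close> are disjoint with \<open>V\<^sub>i\<^sub>+\<^sub>1(S\<^sub>1) = V\<^sub>i(S) = V\<^sub>i\<^sub>+\<^sub>1(S\<^sub>2)\<close>.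
  Then \<open>V\<^sub>i(S)\<close> is full: given two configurations with witnesses over \<open>S\<^sub>1\<close> and \<open>S\<^sub>2\<close>, cut
  a path of each witness behind its \<open>s\<close>-th vertex, which the root does not see, and join the two
  by a path with identifiers from \<open>S\<^sub>3\<close>.  Every interior vertex of the resulting path has only
  branches of rank \<open>i\<close>, so its output is in \<open>V\<^sub>i(S)\<close>.  This gives all lengths in a bounded range, and
  longer paths arise by concatenation.

  If there are no such \<open>S\<^sub>1, S\<^sub>2, S\<^sub>3\<close>, then \<open>V\<^sub>i\<^sub>+\<^sub>1(S') \<subset> V\<^sub>i(S)\<close> for some \<open>S'\<close> that is a third
  of \<open>S\<close>; this can happen at most as often as there are vertex configurations, as the sets
  \<open>V\<^sub>i(S)\<close> are nonempty.
\<close>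

section \<open>Rooted trees\<close>

text \<open>Vertex names double as identifiers. The order of children is invisible in
  \<open>tgraph\<close>, but it lets truncated trees be compared by equality and lets a path run
  through first children.\<close>

datatype rtree = Nd (root: nat) (subs: "rtree list")

primrec tids :: "rtree \<Rightarrow> nat list" where
  "tids (Nd a ts) = a # concat (map tids ts)"

fun tedges :: "rtree \<Rightarrow> nat set set" where
  "tedges (Nd a ts) = (\<Union>t\<in>set ts. insert {a, root t} (tedges t))"

definition tgraph :: "rtree \<Rightarrow> nat graph" where
  "tgraph R = \<lparr>verts = set (tids R), edges = tedges R\<rparr>"

lemma verts_tgraph [simp]: "verts (tgraph R) = set (tids R)"
  and edges_tgraph [simp]: "edges (tgraph R) = tedges R"
  by (simp_all add: tgraph_def)

lemma root_in_tids [simp]: "root R \<in> set (tids R)"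
  by (cases R) simp

text \<open>Removing the first child splits a tree into two smaller rooted trees joined by one edge.
  This avoids a separate induction over lists of children for edges, walks and degrees.\<close>

lemma rtree_cons_induct [case_names Nil Cons]:
  assumes "\<And>a. P (Nd a [])"
    and "\<And>a t ts. P t \<Longrightarrow> P (Nd a ts) \<Longrightarrow> P (Nd a (t # ts))"
  shows "P R"
proof (induction R)
  case (Nd a ts)
  then show ?case
  proof (induction ts)
    case Nil
    show ?case by (rule assms(1))
  next
    case (Cons t ts)
    show ?case
      using Cons by (intro assms(2)) auto
  qed
qed

lemma tedges_Cons: "tedges (Nd a (t # ts)) = insert {a, root t} (tedges t \<union> tedges (Nd a ts))"
  by auto

lemma tids_Cons: "set (tids (Nd a (t # ts))) = set (tids t) \<union> set (tids (Nd a ts))"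
  by auto

lemma distinct_Cons:
  "distinct (tids (Nd a (t # ts))) \<longleftrightarrow>
     distinct (tids t) \<and> distinct (tids (Nd a ts)) \<and> set (tids t) \<inter> set (tids (Nd a ts)) = {}"
  by auto

declare tedges.simps [simp del] tids.simps [simp del]

lemma tedges_Nil [simp]: "tedges (Nd a []) = {}"
  and tids_Nil [simp]: "tids (Nd a []) = [a]"
  by (simp_all add: tedges.simps tids.simps)

lemma tedges_subset: "e \<in> tedges R \<Longrightarrow> e \<subseteq> set (tids R)"
proof (induction R rule: rtree_cons_induct)
  case (Cons a t ts)
  then show ?case
    using root_in_tids[of t] root_in_tids[of "Nd a ts"]
    by (auto simp: tedges_Cons tids_Cons simp del: root_in_tids)
qed simp

lemma tedges_card:
  "distinct (tids R) \<Longrightarrow> e \<in> tedges R \<Longrightarrow> card e = 2"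
proof (induction R rule: rtree_cons_induct)
  case (Cons a t ts)
  have "a \<noteq> root t"
    using Cons.prems(1) root_in_tids[of t] root_in_tids[of "Nd a ts"]
    by (auto simp: distinct_Cons simp del: root_in_tids)
  then show ?case
    using Cons by (auto simp: tedges_Cons distinct_Cons)
qed simp

lemma simple_tgraph: "distinct (tids R) \<Longrightarrow> simple_graph (tgraph R)"
  by (auto simp: simple_graph_def tedges_card dest: tedges_subset)

section \<open>Finite trees\<close>

lemma walk_mono:
  "walk G xs \<Longrightarrow> verts G \<subseteq> verts H \<Longrightarrow> edges G \<subseteq> edges H \<Longrightarrow> walk H xs"
  by (auto simp: walk_def elim: successively_mono)

lemma walk_Cons: "walk G xs \<Longrightarrow> u \<in> verts G \<Longrightarrow> {u, hd xs} \<in> edges G \<Longrightarrow> walk G (u # xs)"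
  by (cases xs) (auto simp: walk_def)

lemma walk_betw_rev: "walk_betw G u xs v \<Longrightarrow> walk_betw G v (rev xs) u"
  by (auto simp: walk_betw_def walk_def hd_rev last_rev successively_rev insert_commute)

lemma walk_betw_trans:
  assumes "walk_betw G u xs v" and "walk_betw G v ys w"
  shows "walk_betw G u (xs @ tl ys) w"
proof -
  obtain ys' where ys: "ys = v # ys'"
    using assms(2) by (cases ys) (auto simp: walk_betw_def walk_def)
  have "successively (\<lambda>a b. {a, b} \<in> edges G) (xs @ ys')"
    using assms ys
    by (cases ys') (auto simp: walk_betw_def walk_def successively_append_iff successively_Cons)
  then show ?thesis
    using assms ys by (auto simp: walk_betw_def walk_def split: if_splits)
qed

lemma walk_from_root: "u \<in> set (tids R) \<Longrightarrow> \<exists>xs. walk_betw (tgraph R) (root R) xs u"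
proof (induction R rule: rtree_cons_induct)
  case (Nil a)
  then show ?case
    by (intro exI[of _ "[a]"]) (simp add: walk_betw_def walk_def)
next
  case (Cons a t ts)
  let ?G = "tgraph (Nd a (t # ts))"
  consider "u \<in> set (tids t)" | "u \<in> set (tids (Nd a ts))"
    using Cons.prems by (auto simp: tids_Cons)
  then show ?case
  proof cases
    case 1
    then obtain xs where xs: "walk_betw (tgraph t) (root t) xs u"
      using Cons.IH by blast
    then have "walk ?G xs"
      by (auto simp: walk_betw_def tids_Cons tedges_Cons elim: walk_mono)
    moreover have "a \<in> verts ?G"
      by (simp add: tids.simps)
    ultimately have "walk ?G (a # xs)"
      using xs by (intro walk_Cons) (auto simp: walk_betw_def tedges_Cons)
    then show ?thesis
      using xs by (intro exI[of _ "a # xs"]) (auto simp: walk_betw_def walk_def)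
  next
    case 2
    then obtain xs where xs: "walk_betw (tgraph (Nd a ts)) a xs u"
      using Cons.IH by auto
    then have "walk ?G xs"
      by (auto simp: walk_betw_def tids_Cons tedges_Cons elim: walk_mono)
    then show ?thesis
      using xs by (auto simp: walk_betw_def)
  qed
qed

lemma connected_tgraph: "connected_graph (tgraph R)"
  unfolding connected_graph_def
  by (metis verts_tgraph walk_betw_rev walk_betw_trans walk_from_root)

text \<open>Ranks can be chosen to grow along every edge away from the root, so the only neighbour
  of rank at most that of \<open>u\<close> is its parent. Minimality of the root's rank is carried
  along for the induction.\<close>

lemma rank_exists:
  "distinct (tids R) \<Longrightarrow> \<exists>r :: nat \<Rightarrow> nat.
     (\<forall>u w w'. {u, w} \<in> tedges R \<and> {u, w'} \<in> tedges R \<and> r w \<le> r u \<and> r w' \<le> r u \<longrightarrow> w = w')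
     \<and> (\<forall>u\<in>set (tids R). u \<noteq> root R \<longrightarrow> r (root R) < r u)"
proof (induction R rule: rtree_cons_induct)
  case (Cons a t ts)
  let ?A = "set (tids (Nd a ts))" and ?B = "set (tids t)"
  obtain p :: "nat \<Rightarrow> nat" where p: "\<And>u w w'. {u, w} \<in> tedges t \<Longrightarrow> {u, w'} \<in> tedges t \<Longrightarrow> p w \<le> p u
      \<Longrightarrow> p w' \<le> p u \<Longrightarrow> w = w'"
    and pr: "\<And>u. u \<in> ?B \<Longrightarrow> u \<noteq> root t \<Longrightarrow> p (root t) < p u"
    using Cons.IH(1) Cons.prems unfolding distinct_Cons by metis
  obtain q :: "nat \<Rightarrow> nat"
    where q: "\<And>u w w'. {u, w} \<in> tedges (Nd a ts) \<Longrightarrow> {u, w'} \<in> tedges (Nd a ts) \<Longrightarrow> q w \<le> q u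
      \<Longrightarrow> q w' \<le> q u \<Longrightarrow> w = w'"
    and qr: "\<And>u. u \<in> ?A \<Longrightarrow> u \<noteq> a \<Longrightarrow> q a < q u"
    using Cons.IH(2) Cons.prems unfolding distinct_Cons rtree.sel by metis
  \<comment> \<open>The ranks in the first child are shifted above that of \<open>a\<close>, so the
    new edge descends only from \<open>root t\<close> to \<open>a\<close>.\<close>
  define r where "r u = (if u \<in> ?B then Suc (q a + p u) else q u)" for u
  have disj: "?A \<inter> ?B = {}" and a: "a \<in> ?A" and rt: "root t \<in> ?B"
    using Cons.prems by (auto simp: distinct_Cons tids.simps)
  have card2: "\<And>u w. {u, w} \<in> tedges t \<Longrightarrow> u \<noteq> w"
    using Cons.prems tedges_card[of t] by (fastforce simp: distinct_Cons)
  have edge: "(w = a \<and> u = root t \<or> p w < p u + 1 \<and> {u, w} \<in> tedges t) \<and> u \<in> ?B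
      \<or> u \<in> ?A \<and> {u, w} \<in> tedges (Nd a ts) \<and> q w \<le> q u"
    if e: "{u, w} \<in> tedges (Nd a (t # ts))" and le: "r w \<le> r u" for u w
  proof -
    consider "u = a" "w = root t" | "w = a" "u = root t" | "{u, w} \<in> tedges t"
      | "{u, w} \<in> tedges (Nd a ts)"
      using e by (auto simp: tedges_Cons doubleton_eq_iff)
    then show ?thesis
    proof cases
      case 1
      moreover have "a \<notin> ?B" using disj a by blast
      ultimately show ?thesis using le rt by (simp add: r_def)
    next
      case 2
      then show ?thesis using rt by simp
    next
      case 3
      then have "u \<in> ?B" "w \<in> ?B"
        using tedges_subset by blast+
      then show ?thesis
        using 3 le by (simp add: r_def)
    next
      case 4
      then have "u \<in> ?A" "w \<in> ?A"
        using tedges_subset by blast+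
      then show ?thesis
        using 4 le disj by (auto simp: r_def split: if_splits)
    qed
  qed
  have "w = w'" if "{u, w} \<in> tedges (Nd a (t # ts))" "{u, w'} \<in> tedges (Nd a (t # ts))"
      "r w \<le> r u" "r w' \<le> r u" for u w w'
  proof (cases "u \<in> ?A")
    case True
    then have "u \<notin> ?B" using disj by blast
    then show ?thesis
      using edge[OF that(1,3)] edge[OF that(2,4)] q by blast
  next
    case False
    note uw = edge[OF that(1,3)] edge[OF that(2,4)]
    have no: False if "{root t, x} \<in> tedges t" "p x < p (root t) + 1" for x
      using card2[OF that(1)] pr[of x] tedges_subset[OF that(1)] that(2) by auto
    from uw False consider "w = a" "w' = a" | "u = root t" "{u, w} \<in> tedges t" "p w < p u + 1"
      | "u = root t" "{u, w'} \<in> tedges t" "p w' < p u + 1"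
      | "{u, w} \<in> tedges t" "{u, w'} \<in> tedges t" "p w \<le> p u" "p w' \<le> p u"
      by auto
    then show ?thesis
      by cases (use no p in \<open>blast+\<close>)
  qed
  moreover have "r a < r u" if "u \<in> set (tids (Nd a (t # ts)))" "u \<noteq> a" for u
    using that qr[of u] disj a by (auto simp: r_def tids_Cons)
  ultimately show ?case
    by (intro exI[of _ r]) auto
qed auto

lemma cycle_nth_edge:
  assumes "cycle G xs" and "j < length xs"
  shows "{xs ! j, xs ! (Suc j mod length xs)} \<in> edges G"
proof (cases "Suc j < length xs")
  case True
  then show ?thesis
    using assms by (simp add: cycle_def walk_def successively_conv_nth)
next
  case False
  then have "j = length xs - 1" "xs \<noteq> []"
    using assms by auto
  then show ?thesis
    using assms by (simp add: cycle_def last_conv_nth hd_conv_nth)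
qed

text \<open>A vertex of maximal rank on a cycle would have two different neighbours of rank at most
  its own.\<close>

lemma acyclic_tgraph:
  assumes "distinct (tids R)"
  shows "\<not> cycle (tgraph R) xs"
proof
  assume c: "cycle (tgraph R) xs"
  define m where "m = length xs"
  have m: "m \<ge> 3" and dist: "distinct xs"
    using c by (auto simp: cycle_def m_def)
  obtain r :: "nat \<Rightarrow> nat" where r: "\<And>u w w'. {u, w} \<in> tedges R \<Longrightarrow> {u, w'} \<in> tedges R \<Longrightarrow> r w \<le> r u
      \<Longrightarrow> r w' \<le> r u \<Longrightarrow> w = w'"
    using rank_exists[OF assms] by blast
  obtain u where u: "u \<in> set xs" and umax: "\<And>w. w \<in> set xs \<Longrightarrow> r w \<le> r u"
  proof -
    have "Max (r ` set xs) \<in> r ` set xs"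
      using m by (intro Max_in) (auto simp: m_def)
    then obtain u where "u \<in> set xs" "r u = Max (r ` set xs)"
      by auto
    then show ?thesis
      using that[of u] by simp
  qed
  obtain j where j: "j < m" "u = xs ! j"
    using u by (auto simp: in_set_conv_nth m_def)
  \<comment> \<open>\<open>i\<close> and \<open>k\<close> are the cyclic predecessor and successor
    of \<open>j\<close>; adding \<open>m\<close> keeps the subtraction from truncating at
    \<open>j = 0\<close>.\<close>
  define i where "i = (j + m - 1) mod m"
  have i: "i < m" "Suc i mod m = j"
  proof -
    show "i < m" using m by (simp add: i_def)
    have "Suc i mod m = Suc (j + m - 1) mod m"
      unfolding i_def by (rule mod_Suc_eq)
    then show "Suc i mod m = j"
      using j m by simp
  qed
  define k where "k = Suc j mod m"
  have k: "k < m" using m by (simp add: k_def)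
  have "{u, xs ! k} \<in> tedges R"
    using cycle_nth_edge[OF c, of j] j by (simp add: m_def k_def)
  moreover have "{u, xs ! i} \<in> tedges R"
    using cycle_nth_edge[OF c, of i] i j by (simp add: m_def insert_commute)
  ultimately have "xs ! k = xs ! i"
    using r umax i k by (simp add: m_def)
  then have "k = i"
    using dist i k by (simp add: nth_eq_iff_index_eq m_def)
  then show False
    using i j m by (auto simp: k_def mod_Suc split: if_splits)
qed

lemma tree_tgraph: "distinct (tids R) \<Longrightarrow> tree (tgraph R)"
  by (metis acyclic_tgraph connected_tgraph root_in_tids simple_tgraph tree_def verts_tgraph
      empty_iff)

section \<open>Degrees\<close>

text \<open>One of the \<open>d\<close> half-edges is reserved for the parent, so this is a
  condition on branches; a whole tree may have \<open>d\<close> children at its root.\<close>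

primrec child_bound :: "nat \<Rightarrow> rtree \<Rightarrow> bool" where
  "child_bound d (Nd a ts) \<longleftrightarrow> length ts \<le> d - 1 \<and> list_all id (map (child_bound d) ts)"

lemma child_bound_Nd [simp]: "child_bound d (Nd a ts) \<longleftrightarrow> length ts \<le> d - 1 \<and> (\<forall>t\<in>set ts. child_bound d t)"
  by (auto simp: list_all_iff)

declare child_bound.simps [simp del]

lemma incident_Cons:
  assumes "distinct (tids (Nd a (t # ts)))"
  shows "incident (tgraph (Nd a (t # ts))) a = insert {a, root t} (incident (tgraph (Nd a ts)) a)"
    and "u \<in> set (tids t) \<Longrightarrow> incident (tgraph (Nd a (t # ts))) u \<subseteq>
       (if u = root t then {{a, u}} else {}) \<union> incident (tgraph t) u"
    and "u \<in> set (tids (Nd a ts)) \<Longrightarrow> u \<noteq> a \<Longrightarrow>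
       incident (tgraph (Nd a (t # ts))) u \<subseteq> incident (tgraph (Nd a ts)) u"
proof -
  have d: "\<And>u. u \<in> set (tids t) \<Longrightarrow> u \<notin> set (tids (Nd a ts))"
    using assms by (auto simp: distinct_Cons)
  have sub: "\<And>e u. e \<in> tedges t \<Longrightarrow> u \<in> e \<Longrightarrow> u \<in> set (tids t)"
    "\<And>e u. e \<in> tedges (Nd a ts) \<Longrightarrow> u \<in> e \<Longrightarrow> u \<in> set (tids (Nd a ts))"
    using tedges_subset by blast+
  note d
  moreover have "a \<in> set (tids (Nd a ts))" by (simp add: tids.simps)
  moreover have "root t \<in> set (tids t)" by simp
  ultimately show "incident (tgraph (Nd a (t # ts))) a = insert {a, root t} (incident (tgraph (Nd a ts)) a)"
    and "u \<in> set (tids t) \<Longrightarrow> incident (tgraph (Nd a (t # ts))) u \<subseteq>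
       (if u = root t then {{a, u}} else {}) \<union> incident (tgraph t) u"
    and "u \<in> set (tids (Nd a ts)) \<Longrightarrow> u \<noteq> a \<Longrightarrow>
       incident (tgraph (Nd a (t # ts))) u \<subseteq> incident (tgraph (Nd a ts)) u"
    by (auto simp: incident_def tedges_Cons split: if_splits dest: sub)
qed

lemma incident_root:
  "distinct (tids R) \<Longrightarrow> incident (tgraph R) (root R) = (\<lambda>t. {root R, root t}) ` set (subs R)"
proof (induction R rule: rtree_cons_induct)
  case (Cons a t ts)
  then show ?case by (simp add: incident_Cons(1) distinct_Cons)
qed (simp add: incident_def)

lemma distinct_roots: "distinct (tids (Nd a ts)) \<Longrightarrow> distinct (map root ts)"
proof (induction ts)
  case (Cons t ts)
  then have "root t \<noteq> root x" if "x \<in> set ts" for x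
    using that root_in_tids[of t] root_in_tids[of x]
    by (auto simp: tids.simps simp del: root_in_tids)
  then show ?case using Cons by (auto simp: distinct_Cons)
qed simp

lemma degree_root:
  assumes "distinct (tids (Nd a ts))"
  shows "degree (tgraph (Nd a ts)) a = length ts"
proof -
  have "inj_on (\<lambda>t. {a, root t}) (set ts)"
    using distinct_roots[OF assms] by (auto simp: inj_on_def doubleton_eq_iff distinct_map)
  then show ?thesis
    using incident_root[OF assms] distinct_roots[OF assms]
    by (simp add: degree_def card_image distinct_card distinct_map)
qed

lemma finite_incident: "finite (incident (tgraph R) u)"
  by (rule finite_subset[of _ "Pow (set (tids R))"])
     (auto simp: incident_def dest: tedges_subset)

lemma degree_nonroot:
  assumes "distinct (tids R)" and "\<forall>t\<in>set (subs R). child_bound d t" and "d \<ge> 1"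
    and "u \<in> set (tids R)" and "u \<noteq> root R"
  shows "degree (tgraph R) u \<le> d"
  using assms
proof (induction R rule: rtree_cons_induct)
  case (Cons a t ts)
  show ?case
  proof (cases "u \<in> set (tids t)")
    case True
    have t: "distinct (tids t)" "child_bound d t"
      using Cons.prems by (auto simp: distinct_Cons)
    have le: "degree (tgraph t) u \<le> (if u = root t then d - 1 else d)"
    proof (cases t)
      case (Nd b us)
      then show ?thesis
        using Cons.IH(1) t True Cons.prems(3) by (auto simp: degree_root)
    qed
    have "degree (tgraph (Nd a (t # ts))) u \<le>
        card ((if u = root t then {{a, u}} else {}) \<union> incident (tgraph t) u)"
      unfolding degree_def
      using incident_Cons(2)[OF Cons.prems(1) True] finite_incident
      by (intro card_mono) auto
    also have "\<dots> \<le> (if u = root t then 1 else 0) + degree (tgraph t) u"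
      unfolding degree_def by (rule order_trans[OF card_Un_le]) auto
    finally show ?thesis
      using le Cons.prems(3) by (auto split: if_splits)
  next
    case False
    then have u: "u \<in> set (tids (Nd a ts))" "u \<noteq> a"
      using Cons.prems by (auto simp: tids_Cons)
    have "degree (tgraph (Nd a (t # ts))) u \<le> degree (tgraph (Nd a ts)) u"
      unfolding degree_def
      by (intro card_mono finite_incident incident_Cons(3)[OF Cons.prems(1) u])
    also have "\<dots> \<le> d"
      using Cons.IH(2) Cons.prems u by (simp add: distinct_Cons)
    finally show ?thesis .
  qed
qed simp

lemma regular_tgraph:
  assumes "distinct (tids R)" and "\<forall>t\<in>set (subs R). child_bound d t" and "d \<ge> 1" and "length (subs R) \<le> d"
  shows "regular_tree d (tgraph R)"
  unfolding regular_tree_def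
proof (intro conjI ballI)
  show "tree (tgraph R)" by (rule tree_tgraph[OF assms(1)])
  fix v assume v: "v \<in> verts (tgraph R)"
  show "degree (tgraph R) v \<le> d"
  proof (cases "v = root R")
    case True
    then show ?thesis using assms by (cases R) (simp add: degree_root)
  next
    case False
    then show ?thesis using degree_nonroot assms v by simp
  qed
qed

text \<open>A root with \<open>d\<close> children has no virtual half-edges, and the roots of its
  children are distinct, so children and half-edges correspond one to one.\<close>

lemma image_half_edges_root:
  assumes "distinct (tids R)" and "length (subs R) = d"
  shows "image_mset h (mset_set (half_edges_at d (tgraph R) (root R))) =
    image_mset (\<lambda>x. h (Real (root R) {root R, root x})) (mset (subs R))"
proof -
  obtain a ts where R: "R = Nd a ts" by (cases R)
  let ?f = "\<lambda>x. Real a {a, root x}"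
  have "half_edges_at d (tgraph R) (root R) = ?f ` set ts"
    using incident_root[OF assms(1)] degree_root assms
    by (auto simp: half_edges_at_def R)
  moreover have "inj_on ?f (set ts)" "distinct ts"
    using distinct_roots assms(1) by (auto simp: R inj_on_def doubleton_eq_iff distinct_map)
  ultimately have "mset_set (half_edges_at d (tgraph R) (root R)) = image_mset ?f (mset ts)"
    by (simp add: mset_set_set image_mset_mset_set[symmetric])
  then show ?thesis
    by (simp add: R image_mset.compositionality comp_def)
qed

section \<open>Views\<close>

text \<open>Every step of a walk inside the ball starts at a vertex of the ball, so equal incidences
  there give the same walks and hence the same ball. Incidence on the boundary is included because a
  view shows degrees.\<close>

lemma neighbourhood_eq:
  fixes G H :: "'a graph"
  assumes G: "simple_graph G" "x \<in> verts G" and H: "simple_graph H" "x \<in> verts H"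
    and inc: "\<And>u. u \<in> ball_verts G x r \<Longrightarrow> incident G u = incident H u"
  shows "neighbourhood G ident x r = neighbourhood H ident x r"
proof -
  have GH: "walk H xs" if "walk G xs" "hd xs = x" "length xs \<le> r + 1" for xs
    using that
  proof (induction xs rule: rev_induct)
    case (snoc u xs)
    show ?case
    proof (cases "xs = []")
      case True
      then show ?thesis using snoc.prems H by (simp add: walk_def)
    next
      case False
      have w: "walk G xs" "{last xs, u} \<in> edges G"
        using snoc.prems False by (auto simp: walk_def successively_append_iff)
      then have "last xs \<in> ball_verts G x r"
        using snoc.prems False by (auto simp: ball_verts_def walk_betw_def walk_def)
      then have "{last xs, u} \<in> edges H"
        using inc w(2) by (auto simp: incident_def)
      moreover have "walk H xs"
        using snoc False w by simp
      ultimately show ?thesis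
        using H(1) by (auto simp: walk_def successively_append_iff simple_graph_def)
    qed
  qed (simp add: walk_def)
  have HG: "walk G xs" if "walk H xs" "hd xs = x" "length xs \<le> r + 1" for xs
    using that
  proof (induction xs rule: rev_induct)
    case (snoc u xs)
    show ?case
    proof (cases "xs = []")
      case True
      then show ?thesis using snoc.prems G by (simp add: walk_def)
    next
      case False
      have w: "walk H xs" "{last xs, u} \<in> edges H"
        using snoc.prems False by (auto simp: walk_def successively_append_iff)
      \<comment> \<open>\<open>inc\<close> speaks of the ball in \<open>G\<close> only, so the
        shorter walk is first transferred to \<open>G\<close>.\<close>
      then have wG: "walk G xs"
        using snoc False by simp
      then have "last xs \<in> ball_verts G x r"
        using snoc.prems False by (auto simp: ball_verts_def walk_betw_def walk_def)
      then have "{last xs, u} \<in> edges G"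
        using inc w(2) by (auto simp: incident_def)
      then show ?thesis
        using G(1) wG by (auto simp: walk_def successively_append_iff simple_graph_def)
    qed
  qed (simp add: walk_def)
  have ball: "ball_verts G x r = ball_verts H x r"
  proof -
    have "walk_betw G x xs u \<and> length xs \<le> r + 1 \<longleftrightarrow> walk_betw H x xs u \<and> length xs \<le> r + 1" for xs u
      using GH HG unfolding walk_betw_def by blast
    moreover have "u \<in> verts G" if "walk_betw G x xs u" for xs u and G :: "'a graph"
      using that unfolding walk_betw_def walk_def by (metis last_in_set subsetD)
    ultimately show ?thesis
      unfolding ball_verts_def by blast
  qed
  have "{e \<in> edges G. e \<subseteq> ball_verts G x r} = {e \<in> edges H. e \<subseteq> ball_verts G x r}"
  proof -
    have "e \<in> edges G \<longleftrightarrow> e \<in> edges H" if e: "e \<subseteq> ball_verts G x r" "e \<noteq> {}" for e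
    proof -
      obtain u where "u \<in> e" "u \<in> ball_verts G x r"
        using e by blast
      then show ?thesis
        using inc[of u] by (auto simp: incident_def)
    qed
    moreover have "e \<noteq> {}" if "e \<in> edges G \<or> e \<in> edges H" for e
      using that G(1) H(1) by (auto simp: simple_graph_def)
    ultimately show ?thesis by blast
  qed
  moreover have "degree G u = degree H u" if "u \<in> ball_verts G x r" for u
    using inc[OF that] by (simp add: degree_def)
  ultimately show ?thesis
    using ball by (simp add: neighbourhood_def cong: image_cong)
qed

section \<open>Levels and truncation of rooted trees\<close>

fun level :: "nat \<Rightarrow> rtree \<Rightarrow> nat set" where
  "level 0 (Nd a ts) = {a}"
| "level (Suc k) (Nd a ts) = (\<Union>t\<in>set ts. level k t)"

fun trunc :: "nat \<Rightarrow> rtree \<Rightarrow> rtree" where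
  "trunc 0 (Nd a ts) = Nd a []"
| "trunc (Suc k) (Nd a ts) = Nd a (map (trunc k) ts)"

lemma root_trunc [simp]: "root (trunc k R) = root R"
  by (cases k; cases R) auto

lemma level_0 [simp]: "level 0 R = {root R}"
  by (cases R) simp

lemma trunc_0 [simp]: "trunc 0 R = Nd (root R) []"
  by (cases R) simp

lemma level_subset: "level k R \<subseteq> set (tids R)"
proof (induction k R rule: level.induct)
  case (2 k a ts)
  then show ?case by (auto simp: tids.simps)
qed (simp add: tids.simps)

lemma distinct_sub: "distinct (tids (Nd a ts)) \<Longrightarrow> t \<in> set ts \<Longrightarrow> distinct (tids t)"
  by (auto simp: tids.simps distinct_concat_iff)

lemma distinct_root: "distinct (tids (Nd a ts)) \<Longrightarrow> t \<in> set ts \<Longrightarrow> a \<notin> set (tids t)"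
  by (auto simp: tids.simps)

lemma distinct_sub_eq:
  assumes "distinct (tids (Nd a ts))" and "t \<in> set ts" and "t' \<in> set ts"
    and "u \<in> set (tids t)" and "u \<in> set (tids t')"
  shows "t = t'"
  using assms
proof (induction ts)
  case (Cons x ts)
  then show ?case by (auto simp: tids.simps)
qed (simp add: tids.simps)

text \<open>By disjointness of the branches, an edge at a vertex \<open>u\<close> below the root
  either leads to the root or stays in the branch of \<open>u\<close>. Hence depth grows by at most
  one along an edge.\<close>

lemma level_edge:
  "distinct (tids R) \<Longrightarrow> u \<in> level k R \<Longrightarrow> {u, w} \<in> tedges R \<Longrightarrow> \<exists>j\<le>Suc k. w \<in> level j R"
proof (induction k R rule: level.induct)
  case (1 a ts)
  from 1 have u: "u = a" by simp
  obtain t where t: "t \<in> set ts" "{u, w} = {a, root t} \<or> {u, w} \<in> tedges t"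
    using 1 by (auto simp: tedges.simps)
  have "a \<notin> set (tids t)"
    using 1 t distinct_root by blast
  then have "{u, w} = {a, root t}"
    using t u tedges_subset by blast
  then have "w = root t"
    using u by (auto simp: doubleton_eq_iff)
  then have "w \<in> level (Suc 0) (Nd a ts)"
    using t by auto
  then show ?case by blast
next
  case (2 k a ts)
  obtain t where t: "t \<in> set ts" "{u, w} = {a, root t} \<or> {u, w} \<in> tedges t"
    using 2 by (auto simp: tedges.simps)
  obtain t' where t': "t' \<in> set ts" "u \<in> level k t'"
    using 2 by auto
  have ut': "u \<in> set (tids t')"
    using t' level_subset by blast
  then have ua: "u \<noteq> a"
    using 2 t' distinct_root by blast
  show ?case
  proof (cases "w = a")
    case True
    then show ?thesis by (intro exI[of _ 0]) simp
  next
    case False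
    then have e: "{u, w} \<in> tedges t"
      using t ua by (auto simp: doubleton_eq_iff)
    then have "u \<in> set (tids t)"
      using tedges_subset by blast
    then have "t = t'"
      using distinct_sub_eq[OF 2(2)] t t' ut' by blast
    then obtain j where "j \<le> Suc k" "w \<in> level j t"
      using 2(1)[OF t(1)] distinct_sub[OF 2(2) t(1)] t'(2) e by blast
    then show ?thesis
      using t(1) by (intro exI[of _ "Suc j"]) auto
  qed
qed

lemma ball_level:
  assumes "distinct (tids R)" and "u \<in> ball_verts (tgraph R) (root R) r"
  shows "\<exists>j\<le>r. u \<in> level j R"
proof -
  have "\<exists>j<length xs. last xs \<in> level j R" if "walk (tgraph R) xs" "hd xs = root R" for xs
    using that
  proof (induction xs rule: rev_induct)
    case (snoc u xs)
    show ?case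
    proof (cases "xs = []")
      case True
      then show ?thesis using snoc.prems by simp
    next
      case False
      then have "walk (tgraph R) xs" "{last xs, u} \<in> tedges R"
        using snoc.prems by (auto simp: walk_def successively_append_iff)
      moreover from this obtain j where "j < length xs" "last xs \<in> level j R"
        using snoc False by auto
      ultimately obtain j' where "j' \<le> Suc j" "u \<in> level j' R" "j < length xs"
        using level_edge[OF assms(1)] by blast
      then show ?thesis by (intro exI[of _ j']) auto
    qed
  qed (simp add: walk_def)
  moreover obtain xs where xs: "walk (tgraph R) xs" "hd xs = root R" "last xs = u" "length xs \<le> r + 1"
    using assms(2) unfolding ball_verts_def walk_betw_def by blast
  ultimately obtain j where "j < length xs" "u \<in> level j R"
    by blast
  then show ?thesis
    using xs(4) by (intro exI[of _ j]) simp
qed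

lemma tids_trunc_subset: "set (tids (trunc m R)) \<subseteq> set (tids R)"
proof (induction m R rule: trunc.induct)
  case (2 k a ts)
  then show ?case by (auto simp: tids.simps)
qed (simp add: tids.simps)

lemma distinct_trunc: "distinct (tids R) \<Longrightarrow> distinct (tids (trunc m R))"
proof (induction R arbitrary: m rule: rtree_cons_induct)
  case (Nil a)
  then show ?case by (cases m) auto
next
  case (Cons a t ts)
  show ?case
  proof (cases m)
    case (Suc k)
    have "trunc m (Nd a ts) = Nd a (map (trunc k) ts)" by (simp add: Suc)
    then show ?thesis
      using Cons.prems Cons.IH(1)[of k] Cons.IH(2)[of m] tids_trunc_subset[of k t]
        tids_trunc_subset[of m "Nd a ts"]
      by (auto simp: distinct_Cons Suc)
  qed simp
qed

lemma tedges_trunc_subset: "tedges (trunc m R) \<subseteq> tedges R"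
proof (induction m R rule: trunc.induct)
  case (2 k a ts)
  then show ?case by (fastforce simp: tedges.simps)
qed simp

text \<open>An edge at depth \<open>k\<close> has its other end at depth at most
  \<open>k + 1\<close>, which truncation at \<open>m > k\<close> keeps.\<close>

lemma tedges_trunc:
  "distinct (tids R) \<Longrightarrow> u \<in> level k R \<Longrightarrow> k < m \<Longrightarrow> u \<in> e \<Longrightarrow> e \<in> tedges R \<Longrightarrow> e \<in> tedges (trunc m R)"
proof (induction k R arbitrary: m rule: level.induct)
  case (1 a ts)
  obtain m' where m: "m = Suc m'" using 1 by (cases m) auto
  obtain t where t: "t \<in> set ts" "e = {a, root t} \<or> e \<in> tedges t"
    using 1 by (auto simp: tedges.simps)
  have "a \<in> e" using 1 by simp
  then have "e \<notin> tedges t"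
    using distinct_root[OF 1(1) t(1)] tedges_subset by blast
  then show ?case
    using t by (auto simp: m tedges.simps)
next
  case (2 k a ts)
  obtain m' where m: "m = Suc m'" "k < m'" using 2 by (cases m) auto
  obtain t where t: "t \<in> set ts" "e = {a, root t} \<or> e \<in> tedges t"
    using 2 by (auto simp: tedges.simps)
  show ?case
  proof (cases "e \<in> tedges t")
    case False
    then show ?thesis using t by (auto simp: m tedges.simps)
  next
    case True
    obtain t' where t': "t' \<in> set ts" "u \<in> level k t'"
      using 2 by auto
    have "u \<in> set (tids t)" "u \<in> set (tids t')"
      using True 2(5) t' level_subset tedges_subset by blast+
    then have "t = t'"
      using distinct_sub_eq[OF 2(2)] t t' by blast
    then have "e \<in> tedges (trunc m' t)"
      using 2(1)[OF t(1) distinct_sub[OF 2(2) t(1)] _ m(2) 2(5) True] t' by blast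
    then show ?thesis
      using t(1) by (auto simp: m tedges.simps)
  qed
qed

text \<open>Depth \<open>r + 1\<close> rather than \<open>r\<close>: the degrees of the boundary
  vertices belong to the view, and the edges they count may end one level deeper.\<close>

lemma neighbourhood_trunc:
  assumes "distinct (tids R)"
  shows "neighbourhood (tgraph R) ident (root R) r
    = neighbourhood (tgraph (trunc (Suc r) R)) ident (root R) r"
proof (rule neighbourhood_eq)
  show "root R \<in> verts (tgraph (trunc (Suc r) R))"
    using root_in_tids[of "trunc (Suc r) R"] by (simp del: root_in_tids)
  fix u assume "u \<in> ball_verts (tgraph R) (root R) r"
  then obtain j where "j \<le> r" "u \<in> level j R"
    using ball_level[OF assms] by blast
  then show "incident (tgraph R) u = incident (tgraph (trunc (Suc r) R)) u"
    using tedges_trunc[OF assms, of u j "Suc r"] tedges_trunc_subset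
    by (auto simp: incident_def)
qed (simp_all add: assms simple_tgraph distinct_trunc)

lemma neighbourhood_cong_trunc:
  assumes "distinct (tids R)" and "distinct (tids R')" and "trunc (Suc r) R = trunc (Suc r) R'"
  shows "neighbourhood (tgraph R) ident (root R) r = neighbourhood (tgraph R') ident (root R') r"
  by (metis assms neighbourhood_trunc root_trunc)

lemma trunc_le: "trunc k R = trunc k R' \<Longrightarrow> j \<le> k \<Longrightarrow> trunc j R = trunc j R'"
proof (induction k R arbitrary: j R' rule: trunc.induct)
  case (2 k a ts)
  obtain b us where R': "R' = Nd b us" by (cases R')
  have e: "a = b" "map (trunc k) ts = map (trunc k) us"
    using 2 by (auto simp: R')
  show ?case
  proof (cases j)
    case (Suc i)
    have "map (trunc i) ts = map (trunc i) us"
    proof (rule nth_equalityI)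
      show len: "length (map (trunc i) ts) = length (map (trunc i) us)"
        using e(2) by (metis length_map)
      fix l assume l: "l < length (map (trunc i) ts)"
      have "trunc k (ts ! l) = trunc k (us ! l)"
        using arg_cong[OF e(2), of "\<lambda>xs. xs ! l"] l len by simp
      then show "map (trunc i) ts ! l = map (trunc i) us ! l"
        using 2(1)[of "ts ! l" "us ! l" i] 2(3) l len Suc by simp
    qed
    then show ?thesis by (simp add: R' Suc e)
  qed (simp add: R' e)
qed auto

lemma level_trunc: "level k (trunc k R) = level k R"
  by (induction k R rule: level.induct) auto

section \<open>Padding\<close>

text \<open>Descend until a leaf is reached and attach \<open>p\<close> there. Following a branch
  with a vertex at depth \<open>k\<close> guarantees that the leaf is at depth at least
  \<open>k\<close>, so the truncation is unchanged; \<open>d \<ge> 2\<close> allows a leaf to get a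
  child.\<close>

lemma add_leaf:
  assumes "d \<ge> 2"
  shows "level k R \<noteq> {} \<Longrightarrow> child_bound d R \<Longrightarrow>
    \<exists>R'. trunc k R' = trunc k R \<and> child_bound d R' \<and> mset (tids R') = add_mset p (mset (tids R))"
proof (induction R arbitrary: k)
  case (Nd a ts)
  show ?case
  proof (cases "ts = []")
    case True
    then have "k = 0" using Nd.prems by (cases k) auto
    then show ?thesis
      using True assms by (intro exI[of _ "Nd a [Nd p []]"]) (simp add: tids.simps)
  next
    case False
    \<comment> \<open>For \<open>k = 0\<close> truncated subtraction gives \<open>k - 1 = 0\<close>,
      so the descent goes on through the first child down to a genuine leaf.\<close>
    obtain x where x: "x \<in> set ts" "level (k - 1) x \<noteq> {}"
    proof (cases k)
      case 0
      then show ?thesis using False that[of "hd ts"] by simp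
    next
      case (Suc j)
      then show ?thesis using Nd.prems that by auto
    qed
    then obtain xs ys where ts: "ts = xs @ x # ys"
      by (meson split_list)
    obtain x' where "trunc (k - 1) x' = trunc (k - 1) x" "child_bound d x'"
      "mset (tids x') = add_mset p (mset (tids x))"
      using Nd.IH[OF x] Nd.prems x(1) by auto
    then show ?thesis
      using Nd.prems by (cases k) (auto simp: ts tids.simps intro!: exI[of _ "Nd a (xs @ x' # ys)"])
  qed
qed

lemma add_leaves:
  assumes "d \<ge> 2" and "level k R \<noteq> {}" and "child_bound d R" and "finite P"
  shows "\<exists>R'. trunc k R' = trunc k R \<and> child_bound d R' \<and> mset (tids R') = mset_set P + mset (tids R)"
  using assms(4)
proof induction
  case empty
  then show ?case using assms by auto
next
  case (insert p P)
  then obtain R' where R': "trunc k R' = trunc k R" "child_bound d R'"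
    "mset (tids R') = mset_set P + mset (tids R)"
    by blast
  then have "level k R' \<noteq> {}"
    using assms(2) by (metis level_trunc)
  then show ?case
    using add_leaf[OF assms(1) _ R'(2), of k p] R' insert by auto
qed

section \<open>Paths with hanging trees\<close>

text \<open>A path is stored as a list so that it can be cut, reversed and concatenated; the value
  at \<open>[]\<close> is a dummy.\<close>

fun path_tree :: "(nat \<times> rtree list) list \<Rightarrow> rtree" where
  "path_tree [] = Nd 0 []"
| "path_tree ((a, h) # L) = Nd a (if L = [] then h else path_tree L # h)"

lemma root_path_tree: "W \<noteq> [] \<Longrightarrow> root (path_tree W) = fst (hd W)"
  by (cases W rule: path_tree.cases) auto

fun path_edges :: "nat list \<Rightarrow> nat set set" where
  "path_edges (a # b # L) = insert {a, b} (path_edges (b # L))"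
| "path_edges _ = {}"

lemma path_edges_append:
  "path_edges (L @ a # M) = path_edges (L @ [a]) \<union> path_edges (a # M)"
proof (induction L)
  case (Cons b L)
  then show ?case by (cases L) auto
qed simp

lemma path_edges_rev: "path_edges (rev L) = path_edges L"
proof (induction L rule: path_edges.induct)
  case (1 a b L)
  have "path_edges (rev (a # b # L)) = path_edges (rev (b # L)) \<union> path_edges [b, a]"
    using path_edges_append[of "rev L" b "[a]"] by simp
  then show ?case
    using 1 by (auto simp: insert_commute)
qed auto

definition hang_edges :: "(nat \<times> rtree list) list \<Rightarrow> nat set set" where
  "hang_edges W = (\<Union>(a, h)\<in>set W. tedges (Nd a h))"

lemma tedges_path_tree: "W \<noteq> [] \<Longrightarrow> tedges (path_tree W) = hang_edges W \<union> path_edges (map fst W)"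
proof (induction W rule: path_tree.induct)
  case (2 a h L)
  show ?case
  proof (cases L)
    case (Cons x M)
    then have "tedges (path_tree L) = hang_edges L \<union> path_edges (map fst L)"
      using 2 by blast
    then show ?thesis
      using Cons by (auto simp: tedges_Cons root_path_tree hang_edges_def)
  qed (simp add: hang_edges_def)
qed simp

text \<open>A multiset records repetitions, so distinctness of the identifiers can be read off and
  carries over to reversed and re-rooted paths.\<close>

definition hang_ids :: "(nat \<times> rtree list) list \<Rightarrow> nat multiset" where
  "hang_ids W = (\<Sum>(a, h)\<leftarrow>W. mset (tids (Nd a h)))"

lemma hang_ids_simps [simp]:
  "hang_ids [] = {#}" "hang_ids ((a, h) # W) = mset (tids (Nd a h)) + hang_ids W"
  "hang_ids (W @ W') = hang_ids W + hang_ids W'"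
  by (auto simp: hang_ids_def)

lemma hang_ids_rev [simp]: "hang_ids (rev W) = hang_ids W"
  by (simp add: hang_ids_def rev_map[symmetric] sum_list_rev)

lemma tids_path_tree: "W \<noteq> [] \<Longrightarrow> mset (tids (path_tree W)) = hang_ids W"
proof (induction W rule: path_tree.induct)
  case (2 a h L)
  then show ?case by (cases "L = []") (auto simp: tids.simps)
qed simp

text \<open>This is the tree of \<open>path_tree W\<close> seen from its \<open>j\<close>-th path
  vertex; thus facts about views of roots apply to every path vertex. The conditionals drop the
  missing branch at an end of the path.\<close>

definition reroot :: "(nat \<times> rtree list) list \<Rightarrow> nat \<Rightarrow> rtree" where
  "reroot W j = Nd (fst (W ! j)) ((if Suc j < length W then [path_tree (drop (Suc j) W)] else [])
     @ (if 0 < j then [path_tree (rev (take j W))] else []) @ snd (W ! j))"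

lemma root_reroot [simp]: "root (reroot W j) = fst (W ! j)"
  by (simp add: reroot_def)

lemma tids_reroot:
  assumes "j < length W"
  shows "mset (tids (reroot W j)) = mset (tids (path_tree W))"
proof -
  obtain a h where ah: "W ! j = (a, h)" by (cases "W ! j")
  have W: "W = take j W @ (a, h) # drop (Suc j) W"
    using id_take_nth_drop[OF assms] ah by simp
  have 1: "mset (tids (path_tree W)) = hang_ids (take j W) + mset (tids (Nd a h)) + hang_ids (drop (Suc j) W)"
    using assms by (subst W, subst tids_path_tree) auto
  have 2: "Suc j < length W \<Longrightarrow> mset (tids (path_tree (drop (Suc j) W))) = hang_ids (drop (Suc j) W)"
    by (rule tids_path_tree) auto
  have "W \<noteq> []" using assms by auto
  then have 3: "0 < j \<Longrightarrow> mset (tids (path_tree (rev (take j W)))) = hang_ids (take j W)"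
    by (simp add: tids_path_tree)
  show ?thesis
    unfolding 1 using assms 2 3 by (auto simp: reroot_def ah tids.simps)
qed

lemma distinct_reroot: "j < length W \<Longrightarrow> distinct (tids (reroot W j)) \<longleftrightarrow> distinct (tids (path_tree W))"
  using tids_reroot mset_eq_imp_distinct_iff by blast

lemma set_tids_reroot: "j < length W \<Longrightarrow> set (tids (reroot W j)) = set (tids (path_tree W))"
  using tids_reroot mset_eq_setD by blast

lemma tedges_reroot:
  assumes "j < length W"
  shows "tedges (reroot W j) = tedges (path_tree W)"
proof -
  obtain a h where ah: "W ! j = (a, h)" by (cases "W ! j")
  define B F where "B = take j W" and "F = drop (Suc j) W"
  have W: "W = B @ (a, h) # F"
    using id_take_nth_drop[OF assms] ah by (simp add: B_def F_def)
  have F: "Suc j < length W \<longleftrightarrow> F \<noteq> []" and B: "0 < j \<longleftrightarrow> B \<noteq> []"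
    using assms by (auto simp: F_def B_def)
  have reroot: "reroot W j = Nd a ((if F \<noteq> [] then [path_tree F] else []) @ (if B \<noteq> [] then [path_tree (rev B)] else []) @ h)"
    using F B by (simp add: reroot_def ah B_def F_def)
  have bpart: "path_edges (map fst B @ [a]) = insert {a, fst (last B)} (path_edges (map fst B))" if ne: "B \<noteq> []"
  proof -
    obtain C c where C: "B = C @ [c]" using ne by (meson rev_exhaust)
    show ?thesis
      using path_edges_append[of "map fst C" "fst c" "[a]"] by (simp add: C insert_commute Un_commute)
  qed
  have fpart: "path_edges (a # map fst F) = insert {a, fst (hd F)} (path_edges (map fst F))" if "F \<noteq> []"
    using that by (cases F) auto
  have 1: "tedges (path_tree W) = hang_edges B \<union> tedges (Nd a h) \<union> hang_edges F
      \<union> path_edges (map fst B @ [a]) \<union> path_edges (a # map fst F)"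
    using path_edges_append[of "map fst B" a "map fst F"]
    by (subst tedges_path_tree) (auto simp: W hang_edges_def)
  have hr: "hang_edges (rev B) = hang_edges B"
    by (simp add: hang_edges_def)
  have pr: "path_edges (map fst (rev B)) = path_edges (map fst B)"
    by (metis path_edges_rev rev_map)
  have 2: "tedges (path_tree (rev B)) = hang_edges B \<union> path_edges (map fst B)" if "B \<noteq> []"
    using that by (simp add: tedges_path_tree hr pr)
  show ?thesis
    unfolding 1 reroot
    by (cases "B = []"; cases "F = []")
       (simp_all add: tedges_Cons tedges_path_tree[of F] 2 bpart fpart root_path_tree hd_rev Un_ac,
         auto simp: hang_edges_def)
qed

lemma tgraph_reroot: "j < length W \<Longrightarrow> tgraph (reroot W j) = tgraph (path_tree W)"
  by (simp add: tgraph_def tedges_reroot set_tids_reroot)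

section \<open>Truncation of paths\<close>

definition trunc_hangs :: "nat \<Rightarrow> (nat \<times> rtree list) list \<Rightarrow> (nat \<times> rtree list) list" where
  "trunc_hangs r = map (\<lambda>(a, h). (a, map (trunc r) h))"

lemma trunc_path_tree:
  "trunc_hangs r W = trunc_hangs r W' \<Longrightarrow> W \<noteq> [] \<Longrightarrow> trunc (Suc r) (path_tree W) = trunc (Suc r) (path_tree W')"
proof (induction W arbitrary: W' rule: path_tree.induct)
  case (2 a h L)
  then obtain h' L' where W': "W' = (a, h') # L'" and h: "map (trunc r) h = map (trunc r) h'"
    and L: "trunc_hangs r L = trunc_hangs r L'"
    by (cases W') (auto simp: trunc_hangs_def)
  have LL: "L = [] \<longleftrightarrow> L' = []"
    using L by (auto simp: trunc_hangs_def)
  show ?case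
  proof (cases "L = []")
    case False
    then have "trunc r (path_tree L) = trunc r (path_tree L')"
      using trunc_le[OF 2(1)[OF False L False], of r] by simp
    then show ?thesis
      using False LL h by (simp add: W')
  qed (use LL h in \<open>simp add: W'\<close>)
qed simp

text \<open>A hanging tree starts one step off the path, so what lies below its depth
  \<open>r\<close> is more than \<open>r + 1\<close> steps away from every path vertex.\<close>

lemma trunc_reroot:
  assumes "trunc_hangs r W = trunc_hangs r W'" and "j < length W"
  shows "trunc (Suc r) (reroot W j) = trunc (Suc r) (reroot W' j)"
proof -
  have len: "length W = length W'"
    using assms(1) by (metis trunc_hangs_def length_map)
  have nth: "(case W ! j of (a, h) \<Rightarrow> (a, map (trunc r) h)) = (case W' ! j of (a, h) \<Rightarrow> (a, map (trunc r) h))"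
    using arg_cong[OF assms(1), of "\<lambda>xs. xs ! j"] assms(2) len by (simp add: trunc_hangs_def)
  have "trunc_hangs r (drop (Suc j) W) = trunc_hangs r (drop (Suc j) W')"
    using assms(1) by (simp add: trunc_hangs_def drop_map[symmetric])
  then have 1: "trunc r (path_tree (drop (Suc j) W)) = trunc r (path_tree (drop (Suc j) W'))" if "Suc j < length W"
    using trunc_le[OF trunc_path_tree, of r "drop (Suc j) W" "drop (Suc j) W'" r] that by simp
  have "W \<noteq> []" using assms(2) by auto
  have "trunc_hangs r (rev (take j W)) = trunc_hangs r (rev (take j W'))"
    using assms(1) by (simp add: trunc_hangs_def rev_map[symmetric] take_map[symmetric])
  then have 2: "trunc r (path_tree (rev (take j W))) = trunc r (path_tree (rev (take j W')))" if "0 < j"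
    using trunc_le[OF trunc_path_tree, of r "rev (take j W)" "rev (take j W')" r] that \<open>W \<noteq> []\<close> by simp
  show ?thesis
    using nth 1 2 len by (auto simp: reroot_def split: prod.splits)
qed

text \<open>The first vertex of \<open>M\<close> has depth \<open>length L\<close>, beyond the
  truncation depth.\<close>

lemma trunc_path_tree_append:
  "k < length L \<Longrightarrow> trunc k (path_tree (L @ M)) = trunc k (path_tree (L @ M'))"
proof (induction L arbitrary: k rule: path_tree.induct)
  case (2 a h L)
  show ?case
  proof (cases k)
    case (Suc i)
    then have "L \<noteq> []" "i < length L" using 2(2) by auto
    then show ?thesis using 2(1) Suc by simp
  qed simp
qed simp

section \<open>Hierarchical trees\<close>

text \<open>The path always continues in the first child.\<close>

fun spine :: "nat \<Rightarrow> (rtree \<Rightarrow> bool) \<Rightarrow> nat \<Rightarrow> rtree \<Rightarrow> bool" where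
  "spine d P 0 b \<longleftrightarrow> P b"
| "spine d P (Suc k) b \<longleftrightarrow> (\<exists>a x ts. b = Nd a (x # ts) \<and> length ts = d - 2
     \<and> spine d P k x \<and> (\<forall>y\<in>set ts. P y))"

text \<open>Rank \<open>0\<close> imposes no condition, since degrees are controlled by
  \<open>child_bound\<close>. The parameter \<open>s\<close> is later \<open>Suc r\<close>, so that
  a path outlasts the radius of the view.\<close>

fun ranked :: "nat \<Rightarrow> nat \<Rightarrow> nat \<Rightarrow> rtree \<Rightarrow> bool" where
  "ranked d s 0 b \<longleftrightarrow> True"
| "ranked d s (Suc i) b \<longleftrightarrow> spine d (ranked d s i) s b"

lemma spine_mono: "spine d P k b \<Longrightarrow> (\<And>b. P b \<Longrightarrow> Q b) \<Longrightarrow> spine d Q k b"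
  by (induction k arbitrary: b) auto

lemma ranked_Suc: "ranked d s (Suc i) b \<Longrightarrow> ranked d s i b"
proof (induction i arbitrary: b)
  case (Suc i)
  then have "spine d (ranked d s (Suc i)) s b" by simp
  then have "spine d (ranked d s i) s b" by (rule spine_mono) (rule Suc.IH)
  then show ?case by simp
qed simp

text \<open>The last path vertex can be absorbed into the tree at the end of the path, as
  \<open>P\<close> is closed under adding a root on top of \<open>d - 1\<close> trees.\<close>

lemma spine_Suc:
  assumes "\<And>a ts. length ts = d - 1 \<Longrightarrow> \<forall>t\<in>set ts. P t \<Longrightarrow> P (Nd a ts)" and "d \<ge> 2"
  shows "spine d P (Suc k) b \<Longrightarrow> spine d P k b"
proof (induction k arbitrary: b)
  case 0
  then show ?case using assms by auto
next
  case (Suc k)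
  then show ?case by (metis spine.simps(2))
qed

text \<open>The new vertex prolongs the path of the first child by one vertex, and
  \<open>spine_Suc\<close> shortens it again at the far end.\<close>

lemma ranked_Nd:
  assumes "d \<ge> 2"
  shows "length ts = d - 1 \<Longrightarrow> \<forall>t\<in>set ts. ranked d s i t \<Longrightarrow> ranked d s i (Nd a ts)"
proof (induction i arbitrary: ts a)
  case (Suc i)
  obtain x us where ts: "ts = x # us" using Suc.prems assms by (cases ts) auto
  have "spine d (ranked d s i) s x" using Suc.prems by (simp add: ts)
  moreover have "\<forall>y\<in>set us. ranked d s i y" using Suc.prems ranked_Suc by (auto simp: ts)
  ultimately have "spine d (ranked d s i) (Suc s) (Nd a ts)"
    using Suc.prems by (auto simp: ts)
  then have "spine d (ranked d s i) s (Nd a ts)"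
    by (rule spine_Suc[rotated 2]) (use Suc.IH assms in auto)
  then show ?case by simp
qed simp

text \<open>This makes joining possible: a path of any length is again a branch of rank
  \<open>i\<close> if all trees hanging off it are, so this rank survives cutting and gluing. The
  last vertex has no successor, whence \<open>d - 1\<close>.\<close>

lemma ranked_path_tree:
  assumes "d \<ge> 2"
  shows "\<forall>(a, h)\<in>set L. length h = d - 2 \<and> (\<forall>t\<in>set h. ranked d s i t) \<Longrightarrow>
    length g = d - 1 \<Longrightarrow> \<forall>t\<in>set g. ranked d s i t \<Longrightarrow> ranked d s i (path_tree (L @ [(c, g)]))"
proof (induction L)
  case (Cons x L)
  then show ?case using assms by (cases x) (auto intro!: ranked_Nd)
qed (use assms in \<open>simp add: ranked_Nd\<close>)

lemma child_bound_path_tree: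
  assumes "d \<ge> 2"
  shows "\<forall>(a, h)\<in>set L. length h = d - 2 \<and> (\<forall>t\<in>set h. child_bound d t) \<Longrightarrow>
    length g = d - 1 \<Longrightarrow> \<forall>t\<in>set g. child_bound d t \<Longrightarrow> child_bound d (path_tree (L @ [(c, g)]))"
proof (induction L)
  case (Cons x L)
  then show ?case using assms by (cases x) auto
qed simp

lemma spine_path_tree:
  "spine d P k b \<Longrightarrow> \<exists>L c g. b = path_tree (L @ [(c, g)]) \<and> length L = k \<and> P (Nd c g)
     \<and> (\<forall>(a, h)\<in>set L. length h = d - 2 \<and> (\<forall>t\<in>set h. P t))"
proof (induction k arbitrary: b)
  case 0
  then show ?case by (cases b) auto
next
  case (Suc k)
  then obtain a x ts where b: "b = Nd a (x # ts)" "length ts = d - 2" "spine d P k x" "\<forall>y\<in>set ts. P y"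
    by auto
  then obtain L c g where L: "x = path_tree (L @ [(c, g)])" "length L = k" "P (Nd c g)"
    "\<forall>(a, h)\<in>set L. length h = d - 2 \<and> (\<forall>t\<in>set h. P t)"
    using Suc.IH by blast
  then have "b = path_tree (((a, ts) # L) @ [(c, g)])"
    by (simp add: b)
  then show ?case
    using L b by (intro exI[of _ "(a, ts) # L"] exI[of _ c] exI[of _ g]) auto
qed

lemma level_spine: "spine d P k b \<Longrightarrow> level k b \<noteq> {}"
  by (induction k arbitrary: b) auto

lemma ranked_level: "ranked d s i b \<Longrightarrow> i \<ge> 1 \<Longrightarrow> level s b \<noteq> {}"
  by (cases i) (auto dest: level_spine)

section \<open>Outputs of the algorithm\<close>

lemma child_bound_path_tree_hang: "child_bound d (path_tree W) \<Longrightarrow> (a, h) \<in> set W \<Longrightarrow> t \<in> set h \<Longrightarrow> child_bound d t"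
proof (induction W rule: path_tree.induct)
  case (2 a h L)
  then show ?case by (cases "L = []") auto
qed simp

lemma path_edges_nth: "Suc j < length L \<Longrightarrow> {L ! j, L ! Suc j} \<in> path_edges L"
proof (induction L arbitrary: j rule: path_edges.induct)
  case (1 a b L)
  then show ?case by (cases j) auto
qed auto

lemma mset_eq_mset_set:
  assumes "mset xs = mset_set X" and "finite X"
  shows "distinct xs" and "set xs = X"
proof -
  show "set xs = X"
    using assms by (metis finite_set_mset_mset_set set_mset_mset)
  then show "distinct xs"
    using assms by (metis distinct_count_atmost_1 count_mset_set(1,3))
qed

text \<open>
  \<open>k\<close> interior vertices connect a half-edge labelled \<open>x\<close> to one labelled \<open>y\<close>; \<open>b j\<close> and \<open>f j\<close> label the
  backward and the forward half-edge of vertex \<open>j\<close>, and the end vertices are \<open>0\<close> and \<open>k + 1\<close>.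
\<close>

definition label_walk :: "'a lcl \<Rightarrow> 'a multiset set \<Rightarrow> nat \<Rightarrow> 'a \<Rightarrow> 'a \<Rightarrow> bool" where
  "label_walk \<Pi> V k x y \<longleftrightarrow> (\<exists>f b. f 0 = x \<and> b (Suc k) = y
     \<and> (\<forall>j\<le>k. {#f j, b (Suc j)#} \<in> edge_configs \<Pi>)
     \<and> (\<forall>j. 1 \<le> j \<and> j \<le> k \<longrightarrow> (\<exists>c\<in>V. {#b j, f j#} \<subseteq># c)))"

text \<open>The vertices of all trees below are their own identifiers, whence \<open>id\<close>.\<close>

locale tree_algorithm =
  fixes d n r :: nat and \<Pi> :: "'a lcl" and A :: "view \<Rightarrow> nat half_edge \<Rightarrow> 'a"
  assumes d: "d > 2"
    and correct: "\<And>R. distinct (tids R) \<Longrightarrow> \<forall>t\<in>set (subs R). child_bound d t \<Longrightarrow> length (subs R) \<le> d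
      \<Longrightarrow> set (tids R) = {1..n} \<Longrightarrow> \<exists>h. coloring d \<Pi> (tgraph R) h
        \<and> (\<forall>v e. h (Real v e) = A (neighbourhood (tgraph R) id v r) (Real v e))"
begin

text \<open>The view is evaluated whatever the size of the tree. Padding below shows that such
  labels do occur on trees with \<open>n\<close> vertices.\<close>

definition out_label :: "rtree \<Rightarrow> rtree \<Rightarrow> 'a" where
  "out_label R x = A (neighbourhood (tgraph R) id (root R) r) (Real (root R) {root R, root x})"

definition out :: "rtree \<Rightarrow> 'a multiset" where
  "out R = image_mset (out_label R) (mset (subs R))"

definition core :: "nat \<Rightarrow> nat set \<Rightarrow> rtree \<Rightarrow> bool" where
  "core i S R \<longleftrightarrow> length (subs R) = d \<and> (\<forall>x\<in>set (subs R). ranked d (Suc r) i x \<and> child_bound d x)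
     \<and> distinct (tids R) \<and> set (tids R) \<subseteq> S"

text \<open>This is \<open>V\<^sub>i(S)\<close> of the overview, with
  \<open>s = Suc r\<close>.\<close>

definition outs :: "nat \<Rightarrow> nat set \<Rightarrow> 'a multiset set" where
  "outs i S = out ` {R. core i S R}"

lemma outs_mono: "S \<subseteq> S' \<Longrightarrow> outs (Suc i) S \<subseteq> outs i S'"
  unfolding outs_def core_def using ranked_Suc by blast

lemma d2: "d \<ge> 2"
  using d by simp

lemma out_vertex_config:
  assumes "core i S R" and "i \<ge> 1" and "S \<subseteq> {1..n}"
  shows "out R \<in> vertex_configs \<Pi>"
proof -
  obtain v x us where R: "R = Nd v (x # us)"
    using assms(1) d by (cases R; cases "subs R") (auto simp: core_def)
  define P where "P = {1..n} - set (tids R)"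
  have dist: "distinct (tids R)" and sub: "set (tids R) \<subseteq> {1..n}"
    using assms by (auto simp: core_def)
  have "level (Suc r) x \<noteq> {}" "child_bound d x"
    using assms ranked_level by (auto simp: core_def R)
  then obtain x' where x': "trunc (Suc r) x' = trunc (Suc r) x" "child_bound d x'"
    "mset (tids x') = mset_set P + mset (tids x)"
    using add_leaves[OF d2, of "Suc r" x P] by (auto simp: P_def)
  define R' where "R' = Nd v (x' # us)"
  have "mset (tids R') = mset_set P + mset (tids R)"
    using x' by (simp add: R'_def R tids.simps)
  also have "\<dots> = mset_set (P \<union> set (tids R))"
    using dist by (subst mset_set_Union) (auto simp: P_def mset_set_set)
  also have "P \<union> set (tids R) = {1..n}"
    using sub by (auto simp: P_def)
  finally have ids: "mset (tids R') = mset_set {1..n}" .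
  have dist': "distinct (tids R')" and set': "set (tids R') = {1..n}"
    using mset_eq_mset_set[OF ids] by auto
  have len: "length (subs R') = d" and "\<forall>t\<in>set (subs R'). child_bound d t"
    using assms(1) x' by (auto simp: core_def R R'_def)
  then obtain h where h: "coloring d \<Pi> (tgraph R') h"
    "\<And>v e. h (Real v e) = A (neighbourhood (tgraph R') id v r) (Real v e)"
    using correct[OF dist'] set' by auto
  have tr: "trunc r x' = trunc r x"
    using trunc_le[OF x'(1), of r] by simp
  have nb: "neighbourhood (tgraph R') id v r = neighbourhood (tgraph R) id v r"
    using neighbourhood_cong_trunc[OF dist' dist, of r] tr by (simp add: R R'_def)
  have rt: "root x' = root x"
    using x'(1) by (metis root_trunc)
  have "image_mset h (mset_set (half_edges_at d (tgraph R') v)) = out R"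
    using image_half_edges_root[OF dist' len, of h] rt
    by (simp add: out_def out_label_def[abs_def] R R'_def h(2) nb[unfolded R R'_def])
  moreover have "v \<in> verts (tgraph R')"
    by (simp add: R'_def tids.simps)
  ultimately show ?thesis
    using h(1) unfolding coloring_def by metis
qed

lemma path_label_walk:
  assumes i: "i \<ge> 1" and S: "S \<subseteq> {1..n}"
    and len: "length h1 = d - 1" "length h2 = d - 1"
    and I: "\<forall>(a, h)\<in>set I. length h = d - 2" "I \<noteq> []"
    and W: "W = (v1, h1) # I @ [(v2, h2)]"
    and hang: "\<forall>(a, h)\<in>set W. \<forall>t\<in>set h. ranked d (Suc r) i t \<and> child_bound d t"
    and dist: "distinct (tids (path_tree W))" and ids: "set (tids (path_tree W)) \<subseteq> S"
  shows "label_walk \<Pi> (outs i S) (length I) (out_label (path_tree W) (path_tree (tl W))) (out_label (path_tree (rev W)) (path_tree (tl (rev W))))"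
proof -
  define k where "k = length I"
  have lenW: "length W = Suc (Suc k)"
    by (simp add: W k_def)
  \<comment> \<open>As \<open>d > 2\<close>, the first interior vertex has a hanging tree
    \<open>b\<close>; it will receive the padding.\<close>
  obtain a1 b g I' where I': "I = (a1, b # g) # I'"
  proof -
    obtain a1 h I' where "I = (a1, h) # I'"
      using I(2) by (cases I) auto
    then show ?thesis
      using I(1) d that by (cases h) auto
  qed
  define P where "P = {1..n} - set (tids (path_tree W))"
  have b: "ranked d (Suc r) i b" "child_bound d b"
    using hang by (auto simp: W I')
  then have "level (Suc r) b \<noteq> {}"
    using i ranked_level by blast
  then obtain b' where b': "trunc (Suc r) b' = trunc (Suc r) b" "child_bound d b'"
    "mset (tids b') = mset_set P + mset (tids b)"
    using add_leaves[OF d2, of "Suc r" b P] b by (auto simp: P_def)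
  define W' where "W' = (v1, h1) # ((a1, b' # g) # I') @ [(v2, h2)]"
  have lenW': "length W' = length W"
    by (simp add: W W'_def I')
  have fst: "map fst W' = map fst W"
    by (simp add: W W'_def I')
  have trunc_hangs: "trunc_hangs r W = trunc_hangs r W'"
    using trunc_le[OF b'(1), of r] by (simp add: W W'_def I' trunc_hangs_def)
  have "mset (tids (path_tree W')) = mset_set P + mset (tids (path_tree W))"
    using b'(3) by (subst (1 2) tids_path_tree) (auto simp: W W'_def I' tids.simps)
  also have "\<dots> = mset_set (P \<union> set (tids (path_tree W)))"
    using dist by (subst mset_set_Union) (auto simp: P_def mset_set_set)
  also have "P \<union> set (tids (path_tree W)) = {1..n}"
    using ids S by (auto simp: P_def)
  finally have ids': "mset (tids (path_tree W')) = mset_set {1..n}" .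
  have dist': "distinct (tids (path_tree W'))" and set': "set (tids (path_tree W')) = {1..n}"
    using mset_eq_mset_set[OF ids'] by auto
  have "child_bound d (path_tree (((a1, b' # g) # I') @ [(v2, h2)]))"
    using I len hang b' by (intro child_bound_path_tree[OF d2]) (auto simp: W I')
  then have "length (subs (path_tree W')) \<le> d" "\<forall>t\<in>set (subs (path_tree W')). child_bound d t"
    using len hang d by (auto simp: W'_def W)
  then obtain h where h: "coloring d \<Pi> (tgraph (path_tree W')) h"
    "\<And>v e. h (Real v e) = A (neighbourhood (tgraph (path_tree W')) id v r) (Real v e)"
    using correct[OF dist'] set' by auto
  define v where "v j = fst (W ! j)" for j
  have nb: "neighbourhood (tgraph (path_tree W')) id (v j) r = neighbourhood (tgraph (reroot W j)) id (v j) r"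
    if j: "j < length W" for j
  proof -
    have "fst (W' ! j) = v j"
      using arg_cong[OF fst, of "\<lambda>xs. xs ! j"] j lenW' by (simp add: v_def)
    moreover have "distinct (tids (reroot W j))" "distinct (tids (reroot W' j))"
      using j lenW' dist dist' by (auto simp: distinct_reroot)
    ultimately show ?thesis
      using neighbourhood_cong_trunc[OF _ _ trunc_reroot[OF trunc_hangs j], of id] j lenW'
      by (simp add: tgraph_reroot v_def)
  qed
  have out_label: "h (Real (v j) {v j, root x}) = out_label (reroot W j) x" if "j < length W" for j x
    unfolding out_label_def h(2) nb[OF that] by (simp add: v_def)
  have edge: "{v j, v (Suc j)} \<in> edges (tgraph (path_tree W'))" if "j \<le> k" for j
  proof -
    have "{map fst W ! j, map fst W ! Suc j} \<in> path_edges (map fst W)"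
      using that lenW by (intro path_edges_nth) simp
    then have "{v j, v (Suc j)} \<in> path_edges (map fst W')"
      unfolding fst using that lenW by (simp add: v_def)
    moreover have "W' \<noteq> []"
      by (simp add: W'_def)
    ultimately show ?thesis
      by (simp add: tedges_path_tree)
  qed
  define f where "f j = h (Real (v j) {v j, v (Suc j)})" for j
  define g' where "g' j = h (Real (v j) {v (j - 1), v j})" for j
  have fwd: "f j = out_label (reroot W j) (path_tree (drop (Suc j) W))" if "j \<le> k" for j
  proof -
    have "root (path_tree (drop (Suc j) W)) = v (Suc j)"
      using that lenW by (simp add: root_path_tree hd_drop_conv_nth v_def)
    then show ?thesis
      using out_label[of j "path_tree (drop (Suc j) W)"] that lenW by (simp add: f_def)
  qed
  have bwd: "g' j = out_label (reroot W j) (path_tree (rev (take j W)))" if "1 \<le> j" "j \<le> Suc k" for j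
  proof -
    have "W \<noteq> []" by (simp add: W)
    then have "root (path_tree (rev (take j W))) = v (j - 1)"
      using that lenW by (simp add: root_path_tree hd_rev last_conv_nth v_def)
    then show ?thesis
      using out_label[of j "path_tree (rev (take j W))"] that lenW by (simp add: g'_def insert_commute)
  qed
  have "{#f j, g' (Suc j)#} \<in> edge_configs \<Pi>" if "j \<le> k" for j
    using h(1) edge[OF that] unfolding coloring_def f_def g'_def by simp
  \<comment> \<open>From an interior vertex there are a forward branch, a backward branch and
    \<open>d - 2\<close> hanging trees, all of rank \<open>i\<close>.\<close>
  moreover have "\<exists>c\<in>outs i S. {#g' j, f j#} \<subseteq># c" if j: "1 \<le> j" "j \<le> k" for j
  proof -
    have Wj: "W ! j = I ! (j - 1)" "W ! j \<in> set I"
      using j by (auto simp: W k_def nth_append nth_Cons')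
    have subs: "subs (reroot W j) = path_tree (drop (Suc j) W) # path_tree (rev (take j W)) # snd (W ! j)"
      using j lenW by (simp add: reroot_def)
    have drop: "drop (Suc j) W = drop j I @ [(v2, h2)]"
      using j by (simp add: W k_def)
    have take: "rev (take j W) = rev (take (j - 1) I) @ [(v1, h1)]"
      using j by (cases j) (auto simp: W k_def)
    have hangI: "\<forall>(a, h)\<in>set I. length h = d - 2 \<and> (\<forall>t\<in>set h. ranked d (Suc r) i t)"
      "\<forall>(a, h)\<in>set I. length h = d - 2 \<and> (\<forall>t\<in>set h. child_bound d t)"
      using hang I(1) by (auto simp: W)
    have h12: "\<forall>t\<in>set h1. ranked d (Suc r) i t \<and> child_bound d t" "\<forall>t\<in>set h2. ranked d (Suc r) i t \<and> child_bound d t"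
      using hang by (auto simp: W)
    have "ranked d (Suc r) i (path_tree (drop (Suc j) W)) \<and> child_bound d (path_tree (drop (Suc j) W))"
      unfolding drop using hangI h12 len
      by (intro conjI ranked_path_tree[OF d2] child_bound_path_tree[OF d2]) (fastforce dest: in_set_dropD)+
    moreover have "ranked d (Suc r) i (path_tree (rev (take j W))) \<and> child_bound d (path_tree (rev (take j W)))"
      unfolding take using hangI h12 len
      by (intro conjI ranked_path_tree[OF d2] child_bound_path_tree[OF d2]) (fastforce dest: in_set_takeD)+
    moreover have "length (snd (W ! j)) = d - 2"
      "\<forall>t\<in>set (snd (W ! j)). ranked d (Suc r) i t \<and> child_bound d t"
      using hangI Wj(2) by (auto simp: case_prod_beta)
    moreover have "distinct (tids (reroot W j))" "set (tids (reroot W j)) \<subseteq> S"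
      using dist ids j lenW by (auto simp: distinct_reroot set_tids_reroot)
    ultimately have "core i S (reroot W j)"
      using d by (auto simp: core_def subs)
    moreover have "{#g' j, f j#} \<subseteq># out (reroot W j)"
      using j by (simp add: out_def subs fwd bwd)
    ultimately show ?thesis
      by (auto simp: outs_def)
  qed
  ultimately have "label_walk \<Pi> (outs i S) k (f 0) (g' (Suc k))"
    unfolding label_walk_def by (intro exI[of _ f] exI[of _ g']) auto
  moreover have "f 0 = out_label (path_tree W) (path_tree (tl W))"
    using fwd[of 0] by (simp add: reroot_def W)
  moreover have "reroot W (Suc k) = path_tree (rev W)" "path_tree (rev (take (Suc k) W)) = path_tree (tl (rev W))"
    by (simp_all add: reroot_def W k_def nth_append)
  ultimately show ?thesis
    using bwd[of "Suc k"] by (simp add: k_def)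
qed

end

section \<open>Building trees from fresh identifiers\<close>

text \<open>The tree may use any subset of the offered identifiers; equality with
  \<open>mset_set Y\<close> states at once which they are and that none is repeated.\<close>

definition constructible :: "(rtree \<Rightarrow> bool) \<Rightarrow> nat \<Rightarrow> bool" where
  "constructible P N \<longleftrightarrow> (\<forall>F. finite F \<and> N \<le> card F \<longrightarrow> (\<exists>b Y. Y \<subseteq> F \<and> P b \<and> mset (tids b) = mset_set Y))"

lemma split_card:
  assumes "finite F" and "M + N \<le> card F"
  obtains G H where "G \<subseteq> F" "H \<subseteq> F" "G \<inter> H = {}" "M = card G" "N \<le> card H" "finite G" "finite H"
proof -
  obtain G where G: "G \<subseteq> F" "card G = M"
    using obtain_subset_with_card_n[of M F] assms by auto
  show ?thesis
  proof (rule that[of G "F - G"])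
    show "N \<le> card (F - G)"
      using G assms by (subst card_Diff_subset) (auto intro: finite_subset)
  qed (use G assms finite_subset in auto)
qed

lemma mset_set_Un_disjoint:
  "Y \<subseteq> G \<Longrightarrow> Z \<subseteq> H \<Longrightarrow> G \<inter> H = {} \<Longrightarrow> finite G \<Longrightarrow> finite H \<Longrightarrow>
    mset_set Y + mset_set Z = mset_set (Y \<union> Z)"
  by (subst mset_set_Union) (auto intro: finite_subset)

lemma constructible_forest:
  assumes "constructible P N"
  shows "finite F \<Longrightarrow> m * N \<le> card F \<Longrightarrow> \<exists>ts Y. Y \<subseteq> F \<and> length ts = m \<and> (\<forall>t\<in>set ts. P t)
    \<and> mset (concat (map tids ts)) = mset_set Y"
proof (induction m arbitrary: F)
  case 0
  show ?case by (intro exI[of _ "[]"] exI[of _ "{}"]) simp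
next
  case (Suc m)
  have "N + m * N \<le> card F"
    using Suc.prems by simp
  then obtain G H where GH: "G \<subseteq> F" "H \<subseteq> F" "G \<inter> H = {}" "N = card G" "m * N \<le> card H"
    "finite G" "finite H"
    using split_card Suc.prems(1) by metis
  obtain b Y where b: "Y \<subseteq> G" "P b" "mset (tids b) = mset_set Y"
    using assms GH unfolding constructible_def by blast
  obtain ts Z where ts: "Z \<subseteq> H" "length ts = m" "\<forall>t\<in>set ts. P t" "mset (concat (map tids ts)) = mset_set Z"
    using Suc.IH[of H] GH by auto
  show ?case
    using b ts GH by (intro exI[of _ "b # ts"] exI[of _ "Y \<union> Z"]) (auto simp: mset_set_Un_disjoint)
qed

lemma constructible_Nd:
  assumes "constructible P N" and "finite F" and "1 + m * N \<le> card F"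
  shows "\<exists>a ts Y. Y \<subseteq> F \<and> length ts = m \<and> (\<forall>t\<in>set ts. P t) \<and> mset (tids (Nd a ts)) = mset_set Y"
proof -
  obtain G H where GH: "G \<subseteq> F" "H \<subseteq> F" "G \<inter> H = {}" "1 = card G" "m * N \<le> card H"
    "finite G" "finite H"
    using split_card[OF assms(2,3)] by metis
  obtain a where a: "G = {a}"
    using GH(4) by (metis card_1_singletonE)
  obtain ts Z where ts: "Z \<subseteq> H" "length ts = m" "\<forall>t\<in>set ts. P t" "mset (concat (map tids ts)) = mset_set Z"
    using constructible_forest[OF assms(1), of H m] GH by auto
  have "mset (tids (Nd a ts)) = mset_set {a} + mset_set Z"
    using ts by (simp add: tids.simps)
  also have "\<dots> = mset_set ({a} \<union> Z)"
    using GH ts(1) a by (intro mset_set_Un_disjoint[of _ G _ H]) auto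
  finally have "mset (tids (Nd a ts)) = mset_set ({a} \<union> Z)" .
  moreover have "{a} \<union> Z \<subseteq> F"
    using ts(1) GH(1,2) a by auto
  ultimately show ?thesis
    using ts(2,3) by blast
qed

lemma constructible_path:
  assumes "constructible P N"
  shows "finite F \<Longrightarrow> m * (1 + k * N) \<le> card F \<Longrightarrow> \<exists>M Y. Y \<subseteq> F \<and> length M = m
    \<and> (\<forall>(a, h)\<in>set M. length h = k \<and> (\<forall>t\<in>set h. P t)) \<and> hang_ids M = mset_set Y"
proof (induction m arbitrary: F)
  case 0
  show ?case by (intro exI[of _ "[]"] exI[of _ "{}"]) simp
next
  case (Suc m)
  have "(1 + k * N) + m * (1 + k * N) \<le> card F"
    using Suc.prems by simp
  then obtain G H where GH: "G \<subseteq> F" "H \<subseteq> F" "G \<inter> H = {}" "1 + k * N = card G"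
    "m * (1 + k * N) \<le> card H" "finite G" "finite H"
    using split_card Suc.prems(1) by metis
  obtain a h Y where a: "Y \<subseteq> G" "length h = k" "\<forall>t\<in>set h. P t" "mset (tids (Nd a h)) = mset_set Y"
    using constructible_Nd[OF assms GH(6), of k] GH(4) by auto
  obtain M Z where M: "Z \<subseteq> H" "length M = m" "\<forall>(a, h)\<in>set M. length h = k \<and> (\<forall>t\<in>set h. P t)"
    "hang_ids M = mset_set Z"
    using Suc.IH[OF GH(7,5)] by auto
  show ?case
    using a M GH by (intro exI[of _ "(a, h) # M"] exI[of _ "Y \<union> Z"]) (auto simp: mset_set_Un_disjoint)
qed

lemma constructible_spine:
  assumes "constructible (\<lambda>b. P b \<and> child_bound d b) N" and "d \<ge> 2"
  shows "constructible (\<lambda>b. spine d P k b \<and> child_bound d b) (N + k * (1 + d * N))"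
proof (induction k)
  case 0
  then show ?case using assms by simp
next
  case (Suc k)
  show ?case
    unfolding constructible_def
  proof (intro allI impI, elim conjE)
    fix F :: "nat set"
    assume F: "finite F" and card: "N + Suc k * (1 + d * N) \<le> card F"
    have "(1 + (d - 2) * N) + (N + k * (1 + d * N)) \<le> card F"
    proof -
      have "(d - 2) * N \<le> d * N" by (rule mult_le_mono1) simp
      then show ?thesis using card unfolding mult_Suc by linarith
    qed
    then obtain G H where GH: "G \<subseteq> F" "H \<subseteq> F" "G \<inter> H = {}" "1 + (d - 2) * N = card G"
      "N + k * (1 + d * N) \<le> card H" "finite G" "finite H"
      using split_card F by metis
    obtain a ts Y where a: "Y \<subseteq> G" "length ts = d - 2" "\<forall>t\<in>set ts. P t \<and> child_bound d t"
      "mset (tids (Nd a ts)) = mset_set Y"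
      using constructible_Nd[OF assms(1) GH(6), of "d - 2"] GH(4) by auto
    obtain x Z where x: "Z \<subseteq> H" "spine d P k x" "child_bound d x" "mset (tids x) = mset_set Z"
      using Suc.IH[unfolded constructible_def, rule_format, of H] GH(5,7) by blast
    have "mset (tids (Nd a (x # ts))) = mset (tids (Nd a ts)) + mset (tids x)"
      by (simp add: tids.simps)
    also have "\<dots> = mset_set (Y \<union> Z)"
      using a x GH by (simp add: mset_set_Un_disjoint)
    finally have "mset (tids (Nd a (x # ts))) = mset_set (Y \<union> Z)" .
    moreover have "spine d P (Suc k) (Nd a (x # ts)) \<and> child_bound d (Nd a (x # ts))"
      using a(2,3) x(2,3) assms(2) by auto
    moreover have "Y \<union> Z \<subseteq> F"
      using a(1) x(1) GH(1,2) by blast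
    ultimately show "\<exists>b Y. Y \<subseteq> F \<and> (spine d P (Suc k) b \<and> child_bound d b) \<and> mset (tids b) = mset_set Y"
      by blast
  qed
qed

text \<open>Enough identifiers for one branch of rank \<open>i\<close>: the end tree and
  \<open>s\<close> path vertices with at most \<open>d\<close> hanging trees each.\<close>

fun room :: "nat \<Rightarrow> nat \<Rightarrow> nat \<Rightarrow> nat" where
  "room d s 0 = 1"
| "room d s (Suc i) = room d s i + s * (1 + d * room d s i)"

lemma constructible_ranked:
  assumes "d \<ge> 2"
  shows "constructible (\<lambda>b. ranked d s i b \<and> child_bound d b) (room d s i)"
proof (induction i)
  case 0
  show ?case
    unfolding constructible_def
  proof (intro allI impI, elim conjE)
    fix F :: "nat set"
    assume "finite F" and "room d s 0 \<le> card F"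
    then obtain a where "a \<in> F"
      by (cases "F = {}") auto
    then show "\<exists>b Y. Y \<subseteq> F \<and> (ranked d s 0 b \<and> child_bound d b) \<and> mset (tids b) = mset_set Y"
      by (intro exI[of _ "Nd a []"] exI[of _ "{a}"]) simp
  qed
next
  case (Suc i)
  then show ?case using constructible_spine[OF Suc assms, of s] by simp
qed

lemma room_mono: "i \<le> j \<Longrightarrow> room d s i \<le> room d s j"
  by (rule lift_Suc_mono_le) auto

text \<open>For a fixed rank the size is polynomial in \<open>s\<close>: the recursion has the
  summands \<open>x\<close>, \<open>s\<close> and \<open>d * s * x\<close> with
  \<open>x = room d s i\<close>, each at most the last.\<close>

lemma room_bound:
  assumes "d \<ge> 1" and "s \<ge> 1"
  shows "1 \<le> room d s i \<and> room d s i \<le> (3 * d * s) ^ i"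
proof (induction i)
  case (Suc i)
  let ?x = "room d s i"
  have "1 * ?x \<le> (d * s) * ?x" "s * 1 \<le> s * (d * ?x)"
    using assms Suc by (intro mult_le_mono; simp)+
  moreover have "s * (d * ?x) = d * s * ?x" "room d s (Suc i) = ?x + s + d * s * ?x"
    by (simp_all add: algebra_simps)
  ultimately have "room d s (Suc i) \<le> 3 * (d * s * ?x)"
    by linarith
  also have "\<dots> = (3 * d * s) * ?x"
    by simp
  also have "\<dots> \<le> (3 * d * s) * (3 * d * s) ^ i"
    using Suc by (intro mult_le_mono) auto
  finally show ?case using Suc by simp
qed simp

section \<open>Walks of labels\<close>

text \<open>The end vertex of the first walk and the start vertex of the second merge into one new
  interior vertex, whose configuration \<open>c\<close> has room for both labels; it accounts for
  the \<open>+ 1\<close>.\<close>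

lemma label_walk_append:
  assumes "label_walk \<Pi> V k x y" and "label_walk \<Pi> V l x' y'" and "c \<in> V" "{#y, x'#} \<subseteq># c"
  shows "label_walk \<Pi> V (k + 1 + l) x y'"
proof -
  obtain f b where f: "f 0 = x" "b (Suc k) = y" "\<forall>j\<le>k. {#f j, b (Suc j)#} \<in> edge_configs \<Pi>"
    "\<forall>j. 1 \<le> j \<and> j \<le> k \<longrightarrow> (\<exists>c\<in>V. {#b j, f j#} \<subseteq># c)"
    using assms(1) unfolding label_walk_def by blast
  obtain f' b' where f': "f' 0 = x'" "b' (Suc l) = y'" "\<forall>j\<le>l. {#f' j, b' (Suc j)#} \<in> edge_configs \<Pi>"
    "\<forall>j. 1 \<le> j \<and> j \<le> l \<longrightarrow> (\<exists>c\<in>V. {#b' j, f' j#} \<subseteq># c)"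
    using assms(2) unfolding label_walk_def by blast
  define F where "F j = (if j \<le> k then f j else f' (j - Suc k))" for j
  define B where "B j = (if j \<le> Suc k then b j else b' (j - Suc k))" for j
  have "{#F j, B (Suc j)#} \<in> edge_configs \<Pi>" if "j \<le> k + 1 + l" for j
  proof (cases "j \<le> k")
    case False
    then have "{#f' (j - Suc k), b' (Suc (j - Suc k))#} \<in> edge_configs \<Pi>"
      using f'(3) that by auto
    moreover have "Suc (j - Suc k) = j - k" using False by simp
    ultimately show ?thesis using False by (simp add: F_def B_def)
  qed (use f in \<open>simp add: F_def B_def\<close>)
  moreover have "\<exists>c\<in>V. {#B j, F j#} \<subseteq># c" if "1 \<le> j" "j \<le> k + 1 + l" for j
  proof -
    consider "j \<le> k" | "j = Suc k" | "j > Suc k" by linarith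
    then show ?thesis
    proof cases
      case 3
      then have "1 \<le> j - Suc k \<and> j - Suc k \<le> l" using that by arith
      then show ?thesis using f'(4) 3 by (simp add: F_def B_def)
    qed (use f f' assms that in \<open>auto simp: F_def B_def\<close>)
  qed
  ultimately show ?thesis
    unfolding label_walk_def using f f'
    by (intro exI[of _ F] exI[of _ B]) (auto simp: F_def B_def)
qed

text \<open>A longer walk is split into a walk of \<open>K\<close> interior vertices from
  \<open>x\<close> to a half-edge labelled \<open>x\<close> again, a vertex whose configuration
  contains \<open>x\<close> together with a further label \<open>z\<close>, and a walk from
  \<open>z\<close>. Beyond \<open>2 * K + 1\<close> the remainder still has at least
  \<open>K\<close> interior vertices.\<close>

lemma label_walk_extend:
  assumes size: "\<And>c. c \<in> V \<Longrightarrow> size c \<ge> 2"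
    and base: "\<And>k x y. K \<le> k \<Longrightarrow> k \<le> 2 * K + 1 \<Longrightarrow> x \<in> \<Union>(set_mset ` V) \<Longrightarrow> y \<in> \<Union>(set_mset ` V)
      \<Longrightarrow> label_walk \<Pi> V k x y"
  shows "K \<le> k \<Longrightarrow> x \<in> \<Union>(set_mset ` V) \<Longrightarrow> y \<in> \<Union>(set_mset ` V) \<Longrightarrow> label_walk \<Pi> V k x y"
proof (induction k arbitrary: x rule: less_induct)
  case (less k)
  show ?case
  proof (cases "k \<le> 2 * K + 1")
    case False
    obtain c where c: "c \<in> V" "x \<in># c" using less.prems by auto
    obtain c' where c': "c = add_mset x c'" using c by (meson mset_add)
    have "c' \<noteq> {#}" using size[OF c(1)] by (auto simp: c')
    then obtain z where "z \<in># c'" by (rule multiset_nonemptyE)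
    then have z: "{#x, z#} \<subseteq># c"
      by (simp add: c')
    have "z \<in># c"
      using \<open>z \<in># c'\<close> by (simp add: c')
    then have "z \<in> \<Union>(set_mset ` V)"
      using c by auto
    then have 1: "label_walk \<Pi> V (k - K - 1) z y"
      using False less by (intro less.IH) auto
    have "label_walk \<Pi> V K x x"
      using less.prems by (intro base) auto
    then have "label_walk \<Pi> V (K + 1 + (k - K - 1)) x y"
      by (rule label_walk_append[OF _ 1 c(1) z])
    then show ?thesis using False by simp
  qed (use base less.prems in blast)
qed

lemma config_arrange:
  assumes "{#u, w#} \<subseteq># c" and "size c = d"
  shows "\<exists>g. config d g = c \<and> g 0 = u \<and> g 1 = w"
proof -
  obtain xs where xs: "mset xs = c - {#u, w#}" using ex_mset by blast
  then have c: "c = mset (u # w # xs)"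
    using assms(1) by (metis mset.simps(2) add_mset_add_single subset_mset.diff_add union_mset_add_mset_right union_mset_add_mset_left add_0 mset.simps(1) subset_mset.add_diff_inverse)
  have "d = length (u # w # xs)"
    using assms(2) c by simp
  then have "map ((!) (u # w # xs)) [0..<d] = u # w # xs"
    by (simp only: map_nth)
  moreover have "config d ((!) (u # w # xs)) = mset (map ((!) (u # w # xs)) [0..<d])"
    unfolding config_def by (metis atLeast0LessThan mset_map mset_upt)
  ultimately have "config d ((!) (u # w # xs)) = c"
    using c by metis
  then show ?thesis
    by (intro exI[of _ "(!) (u # w # xs)"]) simp
qed

text \<open>A path with \<open>m\<close> vertices has \<open>m - 2\<close> interior ones, whence
  \<open>K + 2\<close>. The end configurations meet the path only in \<open>p 1\<close> and
  \<open>q 0\<close>.\<close>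

lemma full_label_walk:
  assumes d: "d \<ge> 2" and size: "\<And>c. c \<in> V \<Longrightarrow> size c = d"
    and label_walk: "\<And>k x y. K \<le> k \<Longrightarrow> x \<in> \<Union>(set_mset ` V) \<Longrightarrow> y \<in> \<Union>(set_mset ` V) \<Longrightarrow> label_walk \<Pi> V k x y"
  shows "full d \<Pi> (K + 2) V"
  unfolding full_def
proof (intro allI impI ballI, elim conjE)
  fix m c1 c2 and p q :: "nat \<Rightarrow> 'a"
  assume m: "K + 2 \<le> m" and c: "c1 \<in> V" "c2 \<in> V" "config d p = c1" "config d q = c2"
  have "p 1 \<in># c1" "q 0 \<in># c2"
    using d c by (auto simp: config_def)
  then have "label_walk \<Pi> V (m - 2) (p 1) (q 0)"
    using m c by (intro label_walk) auto
  then obtain f b where f: "f 0 = p 1" "b (Suc (m - 2)) = q 0"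
    "\<forall>j\<le>m - 2. {#f j, b (Suc j)#} \<in> edge_configs \<Pi>"
    "\<forall>j. 1 \<le> j \<and> j \<le> m - 2 \<longrightarrow> (\<exists>c\<in>V. {#b j, f j#} \<subseteq># c)"
    unfolding label_walk_def by blast
  have "\<exists>g. config d g \<in> V \<and> g 0 = b j \<and> g 1 = f j" if "1 \<le> j" "j \<le> m - 2" for j
    using f(4) that config_arrange size by metis
  then obtain g where g: "\<And>j. 1 \<le> j \<Longrightarrow> j \<le> m - 2 \<Longrightarrow> config d (g j) \<in> V \<and> g j 0 = b j \<and> g j 1 = f j"
    by metis
  define lab where "lab j = (if j = 0 then p else if j = m - 1 then q else g j)" for j
  have "{#lab j 1, lab (j + 1) 0#} \<in> edge_configs \<Pi>" if "j + 1 < m" for j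
  proof -
    have "lab j 1 = f j"
      using that f g[of j] by (auto simp: lab_def)
    moreover have "lab (j + 1) 0 = b (Suc j)"
      using that f g[of "Suc j"] m by (auto simp: lab_def Suc_diff_Suc numeral_2_eq_2)
    ultimately show ?thesis using f(3) that by simp
  qed
  moreover have "config d (lab j) \<in> V" if "0 < j \<and> j < m - 1" for j
    using that g[of j] by (auto simp: lab_def)
  ultimately show "\<exists>lab. (\<forall>j<d. lab 0 j = p j) \<and> (\<forall>j<d. lab (m - 1) j = q j)
      \<and> (\<forall>i. 0 < i \<and> i < m - 1 \<longrightarrow> config d (lab i) \<in> V)
      \<and> (\<forall>i. i + 1 < m \<longrightarrow> {#lab i 1, lab (i + 1) 0#} \<in> edge_configs \<Pi>)"
    using m by (intro exI[of _ lab]) (auto simp: lab_def)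
qed

section \<open>Joining two witnesses\<close>

lemma distinct_count_le: "(\<And>a. count (mset xs) a \<le> 1) \<Longrightarrow> distinct xs"
  by (metis One_nat_def count_mset_gt_0 distinct_count_atmost_1 le_Suc_eq le_zero_eq not_gr_zero
      count_mset_0_iff)

context tree_algorithm
begin

text \<open>\<open>L\<close> collects the \<open>r + 1\<close> path vertices inside the branch
  \<open>x\<close>; everything from \<open>c\<close> on will be discarded. Only the part that is
  kept is described, its identifiers as a multiset with multiplicities at most one.\<close>

lemma core_spine:
  assumes "core (Suc i) S (Nd v (x # ts))"
  obtains L c g where "Nd v (x # ts) = path_tree (((v, ts) # L) @ [(c, g)])" "x = path_tree (L @ [(c, g)])"
    "length L = Suc r" "length ts = d - 1"
    "\<forall>(a, h)\<in>set L. length h = d - 2"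
    "\<forall>(a, h)\<in>set ((v, ts) # L). \<forall>t\<in>set h. ranked d (Suc r) i t \<and> child_bound d t"
    "\<forall>a. count (hang_ids ((v, ts) # L)) a \<le> 1"
    "set_mset (hang_ids ((v, ts) # L)) \<subseteq> S"
proof -
  have core: "length ts = d - 1" "\<forall>t\<in>set (x # ts). ranked d (Suc r) (Suc i) t \<and> child_bound d t"
    "distinct (tids (Nd v (x # ts)))" "set (tids (Nd v (x # ts))) \<subseteq> S"
    using assms by (auto simp: core_def)
  then have "ranked d (Suc r) (Suc i) x"
    by simp
  then have "spine d (ranked d (Suc r) i) (Suc r) x"
    by (simp only: ranked.simps)
  note spine_path_tree[OF this]
  then obtain L c g where L: "x = path_tree (L @ [(c, g)])" "length L = Suc r"
    "\<forall>(a, h)\<in>set L. length h = d - 2 \<and> (\<forall>t\<in>set h. ranked d (Suc r) i t)"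
    by blast
  have R: "Nd v (x # ts) = path_tree (((v, ts) # L) @ [(c, g)])"
    by (simp add: L)
  have child_bound: "\<forall>(a, h)\<in>set L. \<forall>t\<in>set h. child_bound d t"
  proof -
    have "child_bound d (path_tree (L @ [(c, g)]))"
      using core(2) L(1) by simp
    then show ?thesis
      using child_bound_path_tree_hang by fastforce
  qed
  have ts: "\<forall>t\<in>set ts. ranked d (Suc r) i t \<and> child_bound d t"
    using core(2) ranked_Suc by auto
  have tids: "mset (tids (Nd v (x # ts))) = hang_ids ((v, ts) # L) + mset (tids (Nd c g))"
    unfolding R by (subst tids_path_tree) simp_all
  have "count (hang_ids ((v, ts) # L)) a \<le> 1" for a
  proof -
    have "count (mset (tids (Nd v (x # ts)))) a \<le> 1"
      using core(3) by (simp add: distinct_count_atmost_1)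
    then show ?thesis unfolding tids by simp
  qed
  moreover have "set_mset (hang_ids ((v, ts) # L)) \<subseteq> S"
    using core(4) arg_cong[OF tids, of set_mset] by auto
  ultimately show ?thesis
    using that[OF R L(1,2) core(1)] L(3) child_bound ts by fastforce
qed

lemma out_label_cong_trunc:
  assumes "distinct (tids R)" and "distinct (tids R')" and "trunc (Suc r) R = trunc (Suc r) R'"
    and "root x = root x'"
  shows "out_label R x = out_label R' x'"
proof -
  have "root R = root R'" using assms(3) by (metis root_trunc)
  then show ?thesis
    using neighbourhood_cong_trunc[OF assms(1-3), of id] assms(4) by (simp add: out_label_def)
qed

text \<open>Both witnesses are cut behind their paths and joined through \<open>M\<close>, the
  second one reversed. The interior then consists of \<open>M\<close> and two paths of
  \<open>r + 1\<close> vertices, and disjoint sets of identifiers keep the joined tree distinct.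
  Neither root sees beyond its own path, so the end labels are unchanged.\<close>

lemma join_label_walk:
  assumes i: "i \<ge> 1" and S: "S \<subseteq> {1..n}"
    and R1: "core (Suc i) S1 (Nd v1 (x1 # ts1))" and R2: "core (Suc i) S2 (Nd v2 (x2 # ts2))"
    and sub: "S1 \<subseteq> S" "S2 \<subseteq> S" "X \<subseteq> S"
    and disj: "S1 \<inter> S2 = {}" "S1 \<inter> X = {}" "S2 \<inter> X = {}"
    and M: "\<forall>(a, h)\<in>set M. length h = d - 2 \<and> (\<forall>t\<in>set h. ranked d (Suc r) i t \<and> child_bound d t)"
    and X: "hang_ids M = mset_set X"
  shows "label_walk \<Pi> (outs i S) (length M + 2 * Suc r) (out_label (Nd v1 (x1 # ts1)) x1) (out_label (Nd v2 (x2 # ts2)) x2)"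
proof -
  obtain L1 c1 g1 where L1: "Nd v1 (x1 # ts1) = path_tree (((v1, ts1) # L1) @ [(c1, g1)])"
    "x1 = path_tree (L1 @ [(c1, g1)])" "length L1 = Suc r" "length ts1 = d - 1"
    "\<forall>(a, h)\<in>set L1. length h = d - 2"
    "\<forall>(a, h)\<in>set ((v1, ts1) # L1). \<forall>t\<in>set h. ranked d (Suc r) i t \<and> child_bound d t"
    "\<forall>a. count (hang_ids ((v1, ts1) # L1)) a \<le> 1"
    "set_mset (hang_ids ((v1, ts1) # L1)) \<subseteq> S1"
    by (rule core_spine[OF R1]) (rule that)
  obtain L2 c2 g2 where L2: "Nd v2 (x2 # ts2) = path_tree (((v2, ts2) # L2) @ [(c2, g2)])"
    "x2 = path_tree (L2 @ [(c2, g2)])" "length L2 = Suc r" "length ts2 = d - 1"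
    "\<forall>(a, h)\<in>set L2. length h = d - 2"
    "\<forall>(a, h)\<in>set ((v2, ts2) # L2). \<forall>t\<in>set h. ranked d (Suc r) i t \<and> child_bound d t"
    "\<forall>a. count (hang_ids ((v2, ts2) # L2)) a \<le> 1"
    "set_mset (hang_ids ((v2, ts2) # L2)) \<subseteq> S2"
    by (rule core_spine[OF R2]) (rule that)
  define P where "P = hang_ids ((v1, ts1) # L1)"
  define Q where "Q = hang_ids ((v2, ts2) # L2)"
  define I where "I = L1 @ M @ rev L2"
  define W where "W = (v1, ts1) # I @ [(v2, ts2)]"
  have tidsW: "mset (tids (path_tree W)) = P + mset_set X + Q"
    by (subst tids_path_tree) (auto simp: W_def I_def P_def Q_def X)
  have fin: "finite X"
    using finite_subset[OF order_trans[OF sub(3) S]] by simp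
  have dist: "distinct (tids (path_tree W))"
  proof (rule distinct_count_le)
    fix a
    consider "a \<in> S1" "a \<notin> X" "a \<notin># Q" | "a \<in> X" "a \<notin># P" "a \<notin># Q" | "a \<notin># P" "a \<notin> X"
      using disj L1(8) L2(8) unfolding P_def Q_def by blast
    then show "count (mset (tids (path_tree W))) a \<le> 1"
      using L1(7)[rule_format, of a] L2(7)[rule_format, of a] unfolding tidsW P_def[symmetric] Q_def[symmetric]
      by cases (auto simp: fin not_in_iff count_mset_set')
  qed
  have "set (tids (path_tree W)) = set_mset P \<union> X \<union> set_mset Q"
    using arg_cong[OF tidsW, of set_mset] fin by simp
  then have ids: "set (tids (path_tree W)) \<subseteq> S"
    using L1(8) L2(8) sub unfolding P_def Q_def by blast
  have hang: "\<forall>(a, h)\<in>set W. \<forall>t\<in>set h. ranked d (Suc r) i t \<and> child_bound d t"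
    using L1(6) L2(6) M unfolding W_def I_def by fastforce
  have I: "\<forall>(a, h)\<in>set I. length h = d - 2" "I \<noteq> []"
    using L1(3,5) L2(5) M unfolding I_def by fastforce+
  have c: "label_walk \<Pi> (outs i S) (length I) (out_label (path_tree W) (path_tree (tl W))) (out_label (path_tree (rev W)) (path_tree (tl (rev W))))"
    using path_label_walk[OF i S L1(4) L2(4) I W_def hang dist ids] .
  have dist': "distinct (tids (path_tree (rev W)))"
    using dist tids_path_tree[of W] tids_path_tree[of "rev W"]
    by (metis hang_ids_rev mset_eq_imp_distinct_iff rev_is_Nil_conv)
  have "out_label (path_tree W) (path_tree (tl W)) = out_label (Nd v1 (x1 # ts1)) x1"
  proof (rule out_label_cong_trunc[OF dist])
    show "distinct (tids (Nd v1 (x1 # ts1)))"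
      using R1 by (simp add: core_def)
    have W: "W = ((v1, ts1) # L1) @ (M @ rev L2 @ [(v2, ts2)])"
      by (simp add: W_def I_def)
    \<comment> \<open>The two trees share \<open>r + 2\<close> leading path vertices, which covers
      depth \<open>r + 1\<close>.\<close>
    show "trunc (Suc r) (path_tree W) = trunc (Suc r) (Nd v1 (x1 # ts1))"
      unfolding W L1(1) by (rule trunc_path_tree_append) (simp add: L1(3))
    have "L1 \<noteq> []" using L1(3) by auto
    then show "root (path_tree (tl W)) = root x1"
      unfolding L1(2) by (simp add: root_path_tree W_def I_def)
  qed
  moreover have "out_label (path_tree (rev W)) (path_tree (tl (rev W))) = out_label (Nd v2 (x2 # ts2)) x2"
  proof (rule out_label_cong_trunc[OF dist'])
    show "distinct (tids (Nd v2 (x2 # ts2)))"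
      using R2 by (simp add: core_def)
    have W: "rev W = ((v2, ts2) # L2) @ (rev M @ rev L1 @ [(v1, ts1)])"
      by (simp add: W_def I_def)
    show "trunc (Suc r) (path_tree (rev W)) = trunc (Suc r) (Nd v2 (x2 # ts2))"
      unfolding W L2(1) by (rule trunc_path_tree_append) (simp add: L2(3))
    have "L2 \<noteq> []" using L2(3) by auto
    then show "root (path_tree (tl (rev W))) = root x2"
      unfolding L2(2) by (simp add: root_path_tree W_def I_def)
  qed
  moreover have "length I = length M + 2 * Suc r"
    using L1(3) L2(3) by (simp add: I_def)
  ultimately show ?thesis
    using c by simp
qed

text \<open>All branches of a \<open>core\<close> tree satisfy the same conditions and permuting
  them leaves the graph unchanged, so the branch behind a prescribed label can be moved to the
  front.\<close>

lemma core_first_child: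
  assumes "c \<in> outs i S" and "y \<in># c"
  obtains v x ts where "core i S (Nd v (x # ts))" "out_label (Nd v (x # ts)) x = y"
proof -
  obtain v us where R: "core i S (Nd v us)" "out (Nd v us) = c"
  proof -
    obtain R where "core i S R" "out R = c"
      using assms(1) by (auto simp: outs_def)
    then show ?thesis using that by (cases R) auto
  qed
  then obtain x where x: "x \<in> set us" "out_label (Nd v us) x = y"
    using assms(2) by (auto simp: out_def)
  obtain xs ys where us: "us = xs @ x # ys"
    using x(1) by (meson split_list)
  have ids: "mset (tids (Nd v (x # xs @ ys))) = mset (tids (Nd v us))"
    by (simp add: us tids.simps)
  have "tgraph (Nd v (x # xs @ ys)) = tgraph (Nd v us)"
  proof -
    have "tedges (Nd v (x # xs @ ys)) = tedges (Nd v us)"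
      unfolding us tedges.simps by auto
    then show ?thesis
      using mset_eq_setD[OF ids] by (simp add: tgraph_def)
  qed
  moreover have "core i S (Nd v (x # xs @ ys))"
    using R(1) mset_eq_setD[OF ids] mset_eq_imp_distinct_iff[OF ids] by (auto simp: core_def us)
  ultimately show ?thesis
    using that x(2) by (simp add: out_label_def)
qed

section \<open>Fullness of a set of outputs, and the descent\<close>

lemma size_outs: "c \<in> outs i S \<Longrightarrow> size c = d"
  by (auto simp: outs_def out_def core_def)

lemma outs_nonempty:
  assumes "finite S" and "1 + d * room d (Suc r) i \<le> card S"
  shows "outs i S \<noteq> {}"
proof -
  obtain a ts Y where a: "Y \<subseteq> S" "length ts = d" "\<forall>t\<in>set ts. ranked d (Suc r) i t \<and> child_bound d t"
    "mset (tids (Nd a ts)) = mset_set Y"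
    using constructible_Nd[OF constructible_ranked[OF d2] assms] by auto
  have "finite Y" using a(1) assms(1) by (rule finite_subset)
  then have "core i S (Nd a ts)"
    using a mset_eq_mset_set[OF a(4)] by (simp add: core_def)
  then show ?thesis by (auto simp: outs_def)
qed

text \<open>Since both output sets equal \<open>outs i S\<close>, each label occurring there has a
  witness over \<open>S1\<close> and one over \<open>S2\<close>. With \<open>K = 2 * Suc r\<close>
  it remains to treat lengths from \<open>K\<close> to \<open>2 * K + 1\<close>, for which
  \<open>S3\<close> supplies up to \<open>K + 1\<close> connecting vertices.\<close>

lemma full_outs:
  assumes i: "i \<ge> 1" and S: "S \<subseteq> {1..n}" and sub: "S1 \<subseteq> S" "S2 \<subseteq> S" "S3 \<subseteq> S"
    and disj: "S1 \<inter> S2 = {}" "S1 \<inter> S3 = {}" "S2 \<inter> S3 = {}"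
    and card: "(2 * Suc r + 1) * (1 + d * room d (Suc r) i) \<le> card S3"
    and eq: "outs (Suc i) S1 = outs i S" "outs (Suc i) S2 = outs i S"
  shows "full d \<Pi> (2 * Suc r + 2) (outs i S)"
proof (rule full_label_walk)
  show "2 \<le> d" by (rule d2)
  show sz: "size c = d" if "c \<in> outs i S" for c
    using that by (rule size_outs)
  have base: "label_walk \<Pi> (outs i S) k x y"
    if k: "2 * Suc r \<le> k" "k \<le> 2 * (2 * Suc r) + 1"
      and xy: "x \<in> \<Union>(set_mset ` outs i S)" "y \<in> \<Union>(set_mset ` outs i S)" for k x y
  proof -
    obtain c1 where c1: "c1 \<in> outs (Suc i) S1" "x \<in># c1" using xy eq by auto
    obtain c2 where c2: "c2 \<in> outs (Suc i) S2" "y \<in># c2" using xy eq by auto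
    obtain v1 x1 ts1 where R1: "core (Suc i) S1 (Nd v1 (x1 # ts1))" "out_label (Nd v1 (x1 # ts1)) x1 = x"
      using core_first_child[OF c1] .
    obtain v2 x2 ts2 where R2: "core (Suc i) S2 (Nd v2 (x2 # ts2))" "out_label (Nd v2 (x2 # ts2)) x2 = y"
      using core_first_child[OF c2] .
    define m where "m = k - 2 * Suc r"
    have "m * (1 + (d - 2) * room d (Suc r) i) \<le> (2 * Suc r + 1) * (1 + d * room d (Suc r) i)"
      using k by (intro mult_le_mono add_mono) (auto simp: m_def)
    moreover have fin: "finite S3" using sub S by (meson finite_atLeastAtMost finite_subset)
    ultimately obtain M X where M: "X \<subseteq> S3" "length M = m"
      "\<forall>(a, h)\<in>set M. length h = d - 2 \<and> (\<forall>t\<in>set h. ranked d (Suc r) i t \<and> child_bound d t)"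
      "hang_ids M = mset_set X"
      using constructible_path[OF constructible_ranked[OF d2, of "Suc r" i] fin, of m "d - 2"] card by auto
    have "label_walk \<Pi> (outs i S) (length M + 2 * Suc r) x y"
      using join_label_walk[OF i S R1(1) R2(1) sub(1,2) _ disj(1) _ _ M(3,4)] R1(2) R2(2) M(1) sub disj
      by blast
    moreover have "length M + 2 * Suc r = k"
      using M(2) k by (simp add: m_def)
    ultimately show ?thesis by simp
  qed
  show "label_walk \<Pi> (outs i S) k x y"
    if "2 * Suc r \<le> k" "x \<in> \<Union>(set_mset ` outs i S)" "y \<in> \<Union>(set_mset ` outs i S)" for k x y
    using label_walk_extend[of "outs i S" "2 * Suc r" \<Pi> k x y] base that sz d by fastforce
qed

text \<open>\<open>k\<close> bounds the number of configurations present, hence the number of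
  further descents; each raises the rank by one and divides the guaranteed number of identifiers by
  three. \<open>D\<close> bounds all ranks that occur, so one \<open>B\<close> serves throughout. At
  \<open>k = 0\<close> the output set would be empty, against \<open>outs_nonempty\<close>.\<close>

lemma full_exists:
  assumes fin: "finite (vertex_configs \<Pi>)"
    and B: "B = (2 * Suc r + 1) * (1 + d * room d (Suc r) D)"
  shows "i \<ge> 1 \<Longrightarrow> i + k \<le> D \<Longrightarrow> S \<subseteq> {1..n} \<Longrightarrow> 3 ^ k * B \<le> card S \<Longrightarrow> card (outs i S) \<le> k
    \<Longrightarrow> \<exists>V. V \<subseteq> vertex_configs \<Pi> \<and> V \<noteq> {} \<and> full d \<Pi> (2 * Suc r + 2) V"
proof (induction k arbitrary: i S)
  have outs: "outs i S \<subseteq> vertex_configs \<Pi>" "finite (outs i S)" "outs i S \<noteq> {}"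
    "(2 * Suc r + 1) * (1 + d * room d (Suc r) i) \<le> B"
    if S: "i \<ge> 1" "i \<le> D" "S \<subseteq> {1..n}" "B \<le> card S" for i S
  proof -
    show "outs i S \<subseteq> vertex_configs \<Pi>"
      using out_vertex_config S by (auto simp: outs_def)
    then show "finite (outs i S)"
      using fin finite_subset by blast
    have r: "room d (Suc r) i \<le> room d (Suc r) D"
      using S(2) by (rule room_mono)
    then show "(2 * Suc r + 1) * (1 + d * room d (Suc r) i) \<le> B"
      unfolding B by (intro mult_le_mono add_mono) auto
    then have "1 * (1 + d * room d (Suc r) i) \<le> card S"
      using S(4) by (intro order_trans[OF mult_le_mono1[of 1 "2 * Suc r + 1"]]) auto
    then show "outs i S \<noteq> {}"
      using outs_nonempty[of S i] S(3) finite_subset by auto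
  qed
  {
    case 0
    then show ?case using outs[of i S] by auto
  next
    case (Suc k)
    have finS: "finite S" using Suc.prems finite_subset by auto
    have "3 ^ k * B + (3 ^ k * B + 3 ^ k * B) \<le> card S"
      using Suc.prems by simp
    then obtain S1 T where T: "S1 \<subseteq> S" "T \<subseteq> S" "S1 \<inter> T = {}" "3 ^ k * B = card S1"
      "3 ^ k * B + 3 ^ k * B \<le> card T" "finite T"
      using split_card[OF finS] by metis
    then obtain S2 S3 where T2: "S2 \<subseteq> T" "S3 \<subseteq> T" "S2 \<inter> S3 = {}" "3 ^ k * B = card S2"
      "3 ^ k * B \<le> card S3"
      using split_card[OF T(6,5)] by metis
    have B_le: "B \<le> 3 ^ k * B"
      using mult_le_mono1[of 1 "3 ^ k" B] by simp
    then have B_le: "B \<le> 3 ^ k * B" "B \<le> card S"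
      using \<open>3 ^ k * B + (3 ^ k * B + 3 ^ k * B) \<le> card S\<close> by linarith+
    note o = outs[of i S]
    show ?case
    proof (cases "outs (Suc i) S1 = outs i S \<and> outs (Suc i) S2 = outs i S")
      case True
      have "full d \<Pi> (2 * Suc r + 2) (outs i S)"
      proof (rule full_outs[of i S S1 S2 S3])
        show "(2 * Suc r + 1) * (1 + d * room d (Suc r) i) \<le> card S3"
          using o(4) Suc.prems B_le T2 by linarith
      qed (use Suc.prems T T2 True in auto)
      then show ?thesis
        using o Suc.prems B_le by auto
    next
      case False
      then obtain S' where S': "S' \<subseteq> S" "card S' = 3 ^ k * B" "outs (Suc i) S' \<noteq> outs i S"
        using T T2 by (metis order_trans)
      then have "outs (Suc i) S' \<subset> outs i S"
        using outs_mono by blast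
      then have "card (outs (Suc i) S') < card (outs i S)"
        using o Suc.prems B_le by (intro psubset_card_mono) auto
      then show ?thesis
        using Suc.prems S' by (intro Suc.IH[of "Suc i" S']) auto
    qed
  }
qed

end

section \<open>Choice of the number of vertices\<close>

text \<open>For large \<open>n\<close> the exponent in the bound on \<open>t n\<close> is at most
  \<open>1 / (2 * m)\<close>, so the \<open>m\<close>-th power costs only a constant times the
  square root of \<open>n\<close>; the constant \<open>K\<close> is absorbed by
  \<open>n \<ge> K\<^sup>2\<close>.\<close>

lemma subpolynomial_room:
  assumes "subpolynomial t" and m: "m \<ge> 1"
  shows "\<exists>n. c * (e * Suc (t n)) ^ m \<le> n"
proof -
  obtain f :: "nat \<Rightarrow> real" where f: "f \<in> o(\<lambda>_. 1)"
    "\<forall>\<^sub>F n in sequentially. real (t n) \<le> real n powr f n"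
    using assms(1) unfolding subpolynomial_def by blast
  define \<epsilon> where "\<epsilon> = 1 / (2 * real m)"
  define K where "K = c * (2 * e) ^ m"
  have "\<epsilon> > 0" using m by (simp add: \<epsilon>_def)
  have "\<forall>\<^sub>F n in sequentially. norm (f n) \<le> \<epsilon> * norm (1 :: real)"
    using landau_o.smallD[OF f(1) \<open>\<epsilon> > 0\<close>] .
  then have "\<forall>\<^sub>F n in sequentially. norm (f n) \<le> \<epsilon> * norm (1 :: real)
      \<and> real (t n) \<le> real n powr f n \<and> n \<ge> Suc (K\<^sup>2)"
    using f(2) eventually_ge_at_top[of "Suc (K\<^sup>2)"] by eventually_elim simp
  then obtain n where n: "norm (f n) \<le> \<epsilon> * norm (1 :: real)" "real (t n) \<le> real n powr f n"
    "n \<ge> Suc (K\<^sup>2)"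
    by (metis (no_types, lifting) eventually_happens' sequentially_bot)
  have n1: "real n \<ge> 1" using n(3) by simp
  have "real (t n) \<le> real n powr \<epsilon>"
    using n n1 by (intro order_trans[OF n(2)] powr_mono) auto
  \<comment> \<open>This absorbs the successor: \<open>Suc (t n)\<close> is at most twice the power
    of \<open>n\<close>.\<close>
  moreover have "1 \<le> real n powr \<epsilon>"
    using n1 \<open>\<epsilon> > 0\<close> by (intro ge_one_powr_ge_zero) auto
  ultimately have "real e * real (Suc (t n)) \<le> real e * (2 * real n powr \<epsilon>)"
    by (intro mult_left_mono) auto
  then have "(real e * real (Suc (t n))) ^ m \<le> (real e * (2 * real n powr \<epsilon>)) ^ m"
    by (intro power_mono) auto
  also have "\<dots> = (2 * real e) ^ m * (real n powr \<epsilon>) ^ m"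
    by (simp add: power_mult_distrib mult_ac)
  also have "(real n powr \<epsilon>) ^ m = sqrt (real n)"
    using n1 m by (simp add: powr_realpow[symmetric] powr_powr \<epsilon>_def powr_half_sqrt)
  finally have "real c * (real e * real (Suc (t n))) ^ m \<le> real c * ((2 * real e) ^ m * sqrt (real n))"
    by (intro mult_left_mono) auto
  also have "\<dots> = real K * sqrt (real n)"
    by (simp add: K_def)
  also have "\<dots> \<le> sqrt (real n) * sqrt (real n)"
  proof (intro mult_right_mono)
    have "(real K)\<^sup>2 \<le> real n"
      using n(3) by (metis Suc_leD of_nat_mono of_nat_power)
    then show "real K \<le> sqrt (real n)"
      by (rule real_le_rsqrt)
  qed simp
  also have "\<dots> = real n" by simp
  finally have "real (c * (e * Suc (t n)) ^ m) \<le> real n"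
    by (simp only: of_nat_mult of_nat_power)
  then show ?thesis
    by (metis of_nat_le_iff)
qed

lemma finite_multisets_of_size:
  assumes "finite L"
  shows "finite {c. size c = d \<and> set_mset c \<subseteq> L}"
proof (rule finite_subset)
  show "{c. size c = d \<and> set_mset c \<subseteq> L} \<subseteq> mset ` {xs. set xs \<subseteq> L \<and> length xs = d}"
  proof
    fix c assume c: "c \<in> {c. size c = d \<and> set_mset c \<subseteq> L}"
    obtain xs where "mset xs = c" using ex_mset by blast
    then show "c \<in> mset ` {xs. set xs \<subseteq> L \<and> length xs = d}"
      using c by (intro image_eqI[of _ _ xs]) auto
  qed
  show "finite (mset ` {xs. set xs \<subseteq> L \<and> length xs = d})"
    using assms by (intro finite_imageI finite_lists_length_eq)
qed

text \<open>With the vertices \<open>1\<close> to \<open>n\<close> as their own identifiers,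
  \<open>C \<ge> 1\<close> makes the identity admissible, and for fixed \<open>n\<close> the radius
  is the number \<open>t n\<close>.\<close>

lemma tree_algorithm_of_solution:
  assumes "d > 2" and "C \<ge> 1" and "solves C d \<Pi> A t"
  shows "tree_algorithm d n (t n) \<Pi> (A n)"
proof
  show "d > 2" by fact
  fix R assume R: "distinct (tids R)" "\<forall>t\<in>set (subs R). child_bound d t" "length (subs R) \<le> d"
    "set (tids R) = {1..n}"
  have n: "n \<ge> 1"
    using R(4) root_in_tids[of R] by auto
  have "regular_tree d (tgraph R)"
    using R assms(1) by (intro regular_tgraph) auto
  moreover have "{1..n} \<subseteq> {1..n ^ C}"
    using n assms(2) self_le_power[of n C] by auto
  then have "valid_identifiers C (tgraph R) id"
    by (simp add: valid_identifiers_def R(4))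
  ultimately have "coloring d \<Pi> (tgraph R) (run A t (tgraph R) id)"
    using assms(3) unfolding solves_def by blast
  moreover have "run A t (tgraph R) id (Real v e) = A n (neighbourhood (tgraph R) id v (t n)) (Real v e)"
    for v e by (simp add: R(4))
  ultimately show "\<exists>h. coloring d \<Pi> (tgraph R) h
      \<and> (\<forall>v e. h (Real v e) = A n (neighbourhood (tgraph R) id v (t n)) (Real v e))"
    by blast
qed

text \<open>Nonemptiness is part of the claim because the empty set is full for every
  \<open>l\<close>.\<close>

theorem theorem4p6:
  fixes \<Delta> C :: nat and \<Pi> :: "'a lcl"
  assumes "\<Delta> > 2"
    and "lcl_on_regular_trees \<Delta> \<Pi>"
    and "C \<ge> 1"
    and "solvable_in_LOCAL_subpolynomial C \<Delta> \<Pi>"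
  shows "\<exists>l\<ge>2. \<exists>V'. V' \<subseteq> vertex_configs \<Pi> \<and> V' \<noteq> {} \<and> full \<Delta> \<Pi> l V'"
proof -
  obtain A t where A: "subpolynomial t" "solves C \<Delta> \<Pi> A t"
    using assms(4) unfolding solvable_in_LOCAL_subpolynomial_def by blast
  have fin: "finite (vertex_configs \<Pi>)"
    using assms(2) unfolding lcl_on_regular_trees_def
    by (intro finite_subset[OF _ finite_multisets_of_size[of "labels \<Pi>" \<Delta>]]) auto
  define k where "k = card (vertex_configs \<Pi>)"
  \<comment> \<open>Ranks start at \<open>1\<close>, where outputs are known to be vertex
    configurations, and rise at most \<open>k\<close> times.\<close>
  define D where "D = Suc k"
  \<comment> \<open>The exponent is \<open>D\<close> for a branch of the highest rank, plus one for
    the connecting path; \<open>3 ^ k\<close> pays for the descents.\<close>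
  obtain n where n: "3 ^ k * 2 * (3 * \<Delta> * Suc (t n)) ^ Suc D \<le> n"
    using subpolynomial_room[OF A(1), of "Suc D" "3 ^ k * 2" "3 * \<Delta>"] by auto
  interpret tree_algorithm \<Delta> n "t n" \<Pi> "A n"
    using tree_algorithm_of_solution[OF assms(1,3) A(2)] .
  define x where "x = room \<Delta> (Suc (t n)) D"
  define B where "B = (2 * Suc (t n) + 1) * (1 + \<Delta> * x)"
  have x: "1 \<le> x" "x \<le> (3 * \<Delta> * Suc (t n)) ^ D"
    using room_bound[of \<Delta> "Suc (t n)" D] assms(1) unfolding x_def by auto
  have "1 * 1 \<le> \<Delta> * x"
    using x assms(1) by (intro mult_le_mono) auto
  then have "B \<le> (3 * Suc (t n)) * (2 * (\<Delta> * x))"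
    unfolding B_def by (intro mult_le_mono) auto
  also have "\<dots> = 2 * ((3 * \<Delta> * Suc (t n)) * x)"
    by (simp only: ac_simps)
  also have "\<dots> \<le> 2 * ((3 * \<Delta> * Suc (t n)) * (3 * \<Delta> * Suc (t n)) ^ D)"
    using x by (intro mult_le_mono) auto
  finally have "B \<le> 2 * (3 * \<Delta> * Suc (t n)) ^ Suc D"
    by (simp only: power_Suc)
  then have "3 ^ k * B \<le> 3 ^ k * (2 * (3 * \<Delta> * Suc (t n)) ^ Suc D)"
    by (rule mult_le_mono2)
  also have "\<dots> \<le> n"
    using n by (simp only: mult.assoc)
  finally have card: "3 ^ k * B \<le> card {1..n}"
    by simp
  have "outs 1 {1..n} \<subseteq> vertex_configs \<Pi>"
    using out_vertex_config[of 1 "{1..n}"] by (auto simp: outs_def)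
  then have "card (outs 1 {1..n}) \<le> k"
    unfolding k_def using fin by (intro card_mono)
  then obtain V where "V \<subseteq> vertex_configs \<Pi>" "V \<noteq> {}" "full \<Delta> \<Pi> (2 * Suc (t n) + 2) V"
    using full_exists[OF fin, of B D 1 k "{1..n}"] card by (auto simp: B_def x_def D_def)
  then show ?thesis
    by (intro exI[of _ "2 * Suc (t n) + 2"]) auto
qed

end
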